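(* Let $D\subset\mathbb R^d$ be a bounded domain (bounded open set). Assume there exist $\alpha_1,\dots,\alpha_{d-1}\in(0,2]$ and $\beta>0$ such that, for all $x\in D$, one can find an affine map $A$ such that $A(0)=x$, $A(R_{\alpha_1,\dots,\alpha_{d-1}})\subset\overline D$ and $|A(R_{\alpha_1,\dots,\alpha_{d-1}})|\ge\beta\,|D|$. Then $$K_{n,D}\le C_D\,n^{\frac1d\left(2+\sum_{i=1}^{d-1}2/\alpha_i\right)},$$ where $C_D$ is a constant depending only on $D$ (and not on $n$). Here $n$ ranges over the values $n=\binom{d+\ell}{\ell}$, and $K_{n,D}$ is associated to the space $V_n=\mathbb P_\ell$ of polynomials of total degree at most $\ell$.
   Context: $|\cdot|$ denotes Lebesgue measure of sets. For $\alpha_1,\dots,\alpha_{d-1}\in(0,2]$ the reference domain is $$R_{\alpha_1,\dots,\alpha_{d-1}}:=\left\{x\in[-1,1]^d:\ \max_{1\le i\le d-1}|x_i|^{\alpha_i}\le x_d\right\}.$$ $D$ is equipped with the uniform probability measure $\mu_D=|D|^{-1}\chi_D\,dx$ and $L^2(D)=L^2(D,\mu_D)$. $\mathbb P_\ell$ is the space of real polynomials in $d$ variables of total degree at most $\ell$, of dimension $n=\binom{d+\ell}{\ell}$; $V_n=\mathbb P_\ell$. Define $k_{n,D}(x)=\max_{v\in V_n\setminus\{0\}}\frac{|v(x)|^2}{\|v\|_{L^2(D)}^2}$ and $K_{n,D}=\sup_{x\in D}k_{n,D}(x)$.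
   Formalization: The formal theorem additionally assumes that the boundary of D has Lebesgue measure zero; without this the claim fails, e.g. for a dense open union of rapidly shrinking balls in the unit ball, whose closure is the closed ball but for which K_{n,D} grows faster than any power of n. *)

theory Defs
  imports "HOL-Analysis.Analysis"
begin

definition affine_map :: "('a::real_vector \<Rightarrow> 'b::real_vector) \<Rightarrow> bool" where
  "affine_map A \<longleftrightarrow> (\<exists>L b. linear L \<and> A = (\<lambda>x. L x + b))"

text \<open>
  Points of \<open>R^d\<close> are vectors of type \<open>real ^ 'd\<close>, and the index \<open>z\<close> plays the role of the last
  coordinate \<open>d\<close>; the exponents \<open>\<alpha>\<close> matter only at the indices other than \<open>z\<close>.
  The inserted \<open>0\<close> changes nothing if there is another index, since all the powers are nonnegative.
  For \<open>d = 1\<close> it makes the maximum over the empty family \<open>0\<close>, and the domain is \<open>[0,1]\<close>.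
\<close>
definition reference_domain :: "'d::finite \<Rightarrow> ('d \<Rightarrow> real) \<Rightarrow> (real ^ 'd) set" where
  "reference_domain z \<alpha> =
     {x. (\<forall>i. x $ i \<in> {-1..1}) \<and> Max (insert 0 ((\<lambda>i. \<bar>x $ i\<bar> powr \<alpha> i) ` (- {z}))) \<le> x $ z}"

definition exponents :: "nat \<Rightarrow> ('d::finite \<Rightarrow> nat) set" where
  "exponents l = {e. (\<Sum>i\<in>UNIV. e i) \<le> l}"

lemma finite_exponents: "finite (exponents l :: ('d::finite \<Rightarrow> nat) set)"
proof (rule finite_subset)
  show "(exponents l :: ('d \<Rightarrow> nat) set) \<subseteq> Pi\<^sub>E UNIV (\<lambda>_. {..l})"
  proof
    fix e :: "'d \<Rightarrow> nat" assume "e \<in> exponents l"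
    then have "e i \<le> l" for i
      using member_le_sum[of i UNIV e] by (simp add: exponents_def)
    then show "e \<in> Pi\<^sub>E UNIV (\<lambda>_. {..l})" by (simp add: PiE_iff)
  qed
qed (rule finite_PiE; simp)

text \<open>
  Real polynomials of total degree at most \<open>l\<close>, as functions. A polynomial over the infinite field
  of reals is determined by its function, so \<open>v \<noteq> 0\<close> may be read as \<open>v \<noteq> (\<lambda>_. 0)\<close>.
\<close>
definition poly_space :: "nat \<Rightarrow> (real ^ 'd::finite \<Rightarrow> real) set" where
  "poly_space l = {v. \<exists>c. v = (\<lambda>x. \<Sum>e\<in>exponents l. c e * (\<Prod>i\<in>UNIV. x $ i ^ e i))}"

definition L2_norm_on :: "(real ^ 'd::finite) set \<Rightarrow> (real ^ 'd \<Rightarrow> real) \<Rightarrow> real" where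
  "L2_norm_on D v = sqrt (\<integral>x. \<bar>v x\<bar>\<^sup>2 \<partial>(uniform_measure lebesgue D))"

text \<open>
  The extrema are taken in \<open>ennreal\<close>, so that an upper bound on them includes their finiteness.
  For a nonempty bounded open \<open>D\<close> the supremum over the finite-dimensional space \<open>V\<close> is a maximum.
\<close>
definition k_fun ::
  "(real ^ 'd::finite \<Rightarrow> real) set \<Rightarrow> (real ^ 'd) set \<Rightarrow> real ^ 'd \<Rightarrow> ennreal" where
  "k_fun V D x = (SUP v \<in> V - {\<lambda>_. 0}. ennreal (\<bar>v x\<bar>\<^sup>2 / (L2_norm_on D v)\<^sup>2))"

definition K_sup :: "(real ^ 'd::finite \<Rightarrow> real) set \<Rightarrow> (real ^ 'd) set \<Rightarrow> ennreal" where
  "K_sup V D = (SUP x \<in> D. k_fun V D x)"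

end

theory Submission
  imports Defs
begin

text \<open>
  Let \<open>N = l + 1\<close> and \<open>E = 2 + (\<Sum>i\<in>- {z}. 2 / \<alpha> i)\<close>. Pulling a polynomial back along the affine map
  attached to a point \<open>x\<close> of \<open>D\<close> replaces \<open>D\<close> by the reference domain \<open>R\<close> and \<open>x\<close> by its cusp \<open>0\<close>;
  the volume condition bounds the Jacobian that this costs. As \<open>n\<close> is at least \<open>(N / d) ^ d\<close>, it
  remains to prove \<open>w(0)\<^sup>2 \<le> C N powr E * (\<integral> w\<^sup>2 over R)\<close> for polynomials \<open>w\<close> of degree at most \<open>l\<close>.

  This power of \<open>N\<close> is, up to a constant, the inverse volume of the tip of \<open>R\<close> whose height \<open>\<epsilon>\<close> is
  a small multiple of \<open>1 / N\<^sup>2\<close> and whose widths are \<open>\<epsilon> powr (1 / \<alpha> i)\<close>. On the scale \<open>\<epsilon>\<close> a polynomial of degree \<open>l\<close> on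
  \<open>[0, 1]\<close> cannot concentrate at the endpoint \<open>0\<close>: its square there is at most a multiple of \<open>N\<^sup>2\<close>
  times its square integral over \<open>[\<epsilon>, 1]\<close>
  (\<open>polynomial_endpoint_square_le_integral\<close>). Applying this on vertical segments only would leave
  the transversal coordinates to be treated separately, with the loss of a factor \<open>N\<close> for each.
  Instead it is applied along parabolas \<open>(s a, s\<^sup>2 t)\<close> with \<open>a\<close> transversal and \<open>t\<close> vertical, all of
  which pass through \<open>0\<close>. The even part of a polynomial of degree \<open>l\<close> along such a curve is a
  polynomial of degree \<open>l\<close> in \<open>\<tau> = s\<^sup>2\<close>, so nothing is lost
  (\<open>poly_space_even_along_parabola\<close>). Because every \<open>\<alpha> i\<close> is at most \<open>2\<close>, a parabola with
  \<open>t \<le> 1\<close> that lies in \<open>R\<close> at \<open>\<tau> = \<epsilon>\<close> stays in \<open>R\<close> up to \<open>\<tau> = 1\<close>, and only this part of it is needed.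

  Averaging over a box of such parabolas bounds the line integrals by an integral over \<open>R\<close>. The
  parabolic dilation by \<open>\<tau>\<close> is linear for each \<open>\<tau>\<close>, and a point at height \<open>t\<close> is reached only for
  \<open>t \<le> \<tau> \<le> 2 t\<close>, which makes the average over \<open>\<tau>\<close> harmless (\<open>dilation_average_le\<close>).
\<close>

section \<open>Polynomials on an interval near an endpoint\<close>

text \<open>
  The substitution \<open>t = (1 - cos \<theta>) / 2\<close> takes \<open>[0, \<pi>]\<close> to \<open>[0, 1]\<close> and makes the Fourier
  orthogonality of cosines available for polynomials in \<open>t\<close>.
\<close>
lemma polynomial_cosine_expansion:
  fixes b :: "nat \<Rightarrow> real" and l :: nat
  shows "\<exists>a. \<forall>\<theta>. (\<Sum>k\<le>l. b k * ((1 - cos \<theta>) / 2) ^ k) = (\<Sum>j\<le>l. a j * cos (real j * \<theta>))"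
proof -
  have power_expansion: "\<exists>a. (\<forall>j>k. a j = 0) \<and>
      (\<forall>\<theta>. ((1 - cos \<theta>) / 2) ^ k = (\<Sum>j\<le>k. a j * cos (real j * \<theta>)))" for k
  proof (induction k)
    case 0
    show ?case by (rule exI[of _ "\<lambda>j. if j = 0 then 1 else 0"]) simp
  next
    case (Suc k)
    then obtain a where a0: "\<And>j. j > k \<Longrightarrow> a j = 0"
      and a: "\<And>\<theta>. ((1 - cos \<theta>) / 2) ^ k = (\<Sum>j\<le>k. a j * cos (real j * \<theta>))" by auto
    \<comment> \<open>Multiplying by \<open>cos \<theta>\<close> shifts the frequencies up and down by one; frequency \<open>-1\<close> folds back to \<open>1\<close>.\<close>
    define up where "up j = (case j of 0 \<Rightarrow> 0 | Suc i \<Rightarrow> a i)" for j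
    define down where "down j = a (Suc j) + (if j = 1 then a 0 else 0)" for j
    have "((1 - cos \<theta>) / 2) ^ Suc k =
        (\<Sum>j\<le>Suc k. (a j / 2 - up j / 4 - down j / 4) * cos (real j * \<theta>))" for \<theta>
    proof -
      have s0: "(\<Sum>j\<le>Suc k. a j * cos (real j * \<theta>)) = (\<Sum>j\<le>k. a j * cos (real j * \<theta>))"
        using a0 by simp
      have s1: "(\<Sum>j\<le>Suc k. up j * cos (real j * \<theta>)) = (\<Sum>j\<le>k. a j * cos ((real j + 1) * \<theta>))"
        by (subst sum.atMost_Suc_shift) (simp add: up_def add.commute)
      have "(\<Sum>j\<le>k. a j * cos ((real j - 1) * \<theta>))
          = (\<Sum>j\<le>Suc k. a j * cos ((real j - 1) * \<theta>))" using a0 by simp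
      also have "\<dots> = a 0 * cos \<theta> + (\<Sum>j\<le>k. a (Suc j) * cos (real j * \<theta>))"
        by (subst sum.atMost_Suc_shift) simp
      also have "(\<Sum>j\<le>k. a (Suc j) * cos (real j * \<theta>)) = (\<Sum>j\<le>Suc k. a (Suc j) * cos (real j * \<theta>))"
        using a0 by simp
      also have "a 0 * cos \<theta> = (\<Sum>j\<le>Suc k. (if j = 1 then a 0 else 0) * cos (real j * \<theta>))"
        by (simp add: if_distrib[of "\<lambda>x. x * _"] cong: if_cong)
      finally have s2: "(\<Sum>j\<le>Suc k. down j * cos (real j * \<theta>))
          = (\<Sum>j\<le>k. a j * cos ((real j - 1) * \<theta>))"
        by (simp add: down_def sum.distrib distrib_right del: sum.atMost_Suc)
      have "((1 - cos \<theta>) / 2) ^ Suc k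
          = (\<Sum>j\<le>k. a j * (cos (real j * \<theta>) / 2 - cos (real j * \<theta>) * cos \<theta> / 2))"
        unfolding power_Suc a sum_distrib_left by (intro sum.cong refl) (simp add: field_simps)
      also have "\<dots> = (\<Sum>j\<le>k. a j * cos (real j * \<theta>) / 2
          - a j * cos ((real j + 1) * \<theta>) / 4 - a j * cos ((real j - 1) * \<theta>) / 4)"
      proof (intro sum.cong refl)
        fix j
        have "cos (real j * \<theta>) * cos \<theta> = (cos ((real j - 1) * \<theta>) + cos ((real j + 1) * \<theta>)) / 2"
          using cos_times_cos[of "real j * \<theta>" \<theta>] by (simp add: algebra_simps)
        then show "a j * (cos (real j * \<theta>) / 2 - cos (real j * \<theta>) * cos \<theta> / 2)
            = a j * cos (real j * \<theta>) / 2
              - a j * cos ((real j + 1) * \<theta>) / 4 - a j * cos ((real j - 1) * \<theta>) / 4"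
          by (simp add: right_diff_distrib distrib_left add_divide_distrib)
      qed
      also have "\<dots> = (\<Sum>j\<le>Suc k. a j * cos (real j * \<theta>)) / 2
          - (\<Sum>j\<le>Suc k. up j * cos (real j * \<theta>)) / 4 - (\<Sum>j\<le>Suc k. down j * cos (real j * \<theta>)) / 4"
        unfolding s0 s1 s2 by (simp add: sum_subtractf sum_divide_distrib)
      also have "\<dots> = (\<Sum>j\<le>Suc k. (a j / 2 - up j / 4 - down j / 4) * cos (real j * \<theta>))"
        by (simp add: sum_subtractf sum_divide_distrib left_diff_distrib del: sum.atMost_Suc)
      finally show ?thesis .
    qed
    moreover have "a j / 2 - up j / 4 - down j / 4 = 0" if "j > Suc k" for j
      using that a0 by (cases j) (auto simp: up_def down_def)
    ultimately show ?case
      by (intro exI[of _ "\<lambda>j. a j / 2 - up j / 4 - down j / 4"] conjI allI impI)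
  qed
  have "\<exists>a. \<forall>k. (\<forall>j>k. a k j = 0) \<and>
      (\<forall>\<theta>. ((1 - cos \<theta>) / 2) ^ k = (\<Sum>j\<le>k. a k j * cos (real j * \<theta>)))"
    by (intro choice allI) (rule power_expansion)
  then obtain a where a0: "\<And>k j. j > k \<Longrightarrow> a k j = 0"
    and a: "\<And>k \<theta>. ((1 - cos \<theta>) / 2) ^ k = (\<Sum>j\<le>k. a k j * cos (real j * \<theta>))" by auto
  have "(\<Sum>k\<le>l. b k * ((1 - cos \<theta>) / 2) ^ k) = (\<Sum>j\<le>l. (\<Sum>k\<le>l. b k * a k j) * cos (real j * \<theta>))" for \<theta>
  proof -
    have "(\<Sum>k\<le>l. b k * ((1 - cos \<theta>) / 2) ^ k) = (\<Sum>k\<le>l. \<Sum>j\<le>l. b k * a k j * cos (real j * \<theta>))"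
    proof (intro sum.cong refl)
      fix k assume "k \<in> {..l}"
      then have "(\<Sum>j\<le>k. a k j * cos (real j * \<theta>)) = (\<Sum>j\<le>l. a k j * cos (real j * \<theta>))"
        using a0 by (intro sum.mono_neutral_left) auto
      then show "b k * ((1 - cos \<theta>) / 2) ^ k = (\<Sum>j\<le>l. b k * a k j * cos (real j * \<theta>))"
        by (simp add: a sum_distrib_left mult.assoc)
    qed
    also have "\<dots> = (\<Sum>j\<le>l. (\<Sum>k\<le>l. b k * a k j) * cos (real j * \<theta>))"
      by (subst sum.swap) (simp add: sum_distrib_right)
    finally show ?thesis .
  qed
  then show ?thesis by (intro exI[of _ "\<lambda>j. \<Sum>k\<le>l. b k * a k j"] allI)
qed

lemma has_integral_cos_multiple:
  fixes m :: int
  shows "((\<lambda>\<theta>. cos (of_int m * \<theta>)) has_integral (if m = 0 then pi else 0)) {0..pi}"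
proof (cases "m = 0")
  case True
  then show ?thesis using has_integral_const_real[of "1::real" 0 pi] by simp
next
  case False
  have "((\<lambda>\<theta>. cos (of_int m * \<theta>)) has_integral
      (sin (of_int m * pi) / of_int m - sin (of_int m * 0) / of_int m)) {0..pi}"
    using False by (intro fundamental_theorem_of_calculus)
      (auto intro!: derivative_eq_intros simp: has_real_derivative_iff_has_vector_derivative[symmetric])
  moreover have "sin (of_int m * pi) = 0" by (metis mult.commute sin_npi_int)
  ultimately show ?thesis using False by simp
qed

lemma has_integral_cos_times_cos:
  fixes j k :: nat
  shows "((\<lambda>\<theta>. cos (real j * \<theta>) * cos (real k * \<theta>)) has_integral
     (if j = k then (if j = 0 then pi else pi / 2) else 0)) {0..pi}"
proof -
  have "((\<lambda>\<theta>. (cos (of_int (int j - int k) * \<theta>) + cos (of_int (int j + int k) * \<theta>)) / 2) has_integral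
     ((if int j - int k = 0 then pi else 0) + (if int j + int k = 0 then pi else 0)) / 2) {0..pi}"
    by (intro has_integral_divide has_integral_add has_integral_cos_multiple)
  moreover have "(cos (of_int (int j - int k) * \<theta>) + cos (of_int (int j + int k) * \<theta>)) / 2
      = cos (real j * \<theta>) * cos (real k * \<theta>)" for \<theta>
    by (simp add: cos_times_cos algebra_simps)
  moreover have "((if int j - int k = 0 then pi else 0) + (if int j + int k = 0 then pi else 0)) / 2
      = (if j = k then (if j = 0 then pi else pi / 2) else 0)" by auto
  ultimately show ?thesis by (simp only:)
qed

text \<open>
  By orthogonality the integral controls the sum of the squared coefficients, and the
  Cauchy-Schwarz inequality for the \<open>l + 1\<close> terms gives the bound at each point.
\<close>
lemma cosine_sum_square_le_integral:
  fixes a :: "nat \<Rightarrow> real" and l :: nat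
  defines "f \<equiv> \<lambda>\<theta>. \<Sum>j\<le>l. a j * cos (real j * \<theta>)"
  shows "(f \<theta>)\<^sup>2 \<le> 2 * (real l + 1) / pi * integral {0..pi} (\<lambda>\<theta>. (f \<theta>)\<^sup>2)"
proof -
  have "((\<lambda>\<theta>. \<Sum>j\<le>l. \<Sum>k\<le>l. a j * a k * (cos (real j * \<theta>) * cos (real k * \<theta>))) has_integral
     (\<Sum>j\<le>l. \<Sum>k\<le>l. a j * a k * (if j = k then (if j = 0 then pi else pi / 2) else 0))) {0..pi}"
    by (intro has_integral_sum has_integral_mult_right has_integral_cos_times_cos) auto
  moreover have "(\<Sum>j\<le>l. \<Sum>k\<le>l. a j * a k * (cos (real j * \<theta>) * cos (real k * \<theta>))) = (f \<theta>)\<^sup>2" for \<theta>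
    by (simp add: f_def power2_eq_square sum_product mult_ac)
  ultimately have I: "integral {0..pi} (\<lambda>\<theta>. (f \<theta>)\<^sup>2) =
      (\<Sum>j\<le>l. a j * a j * (if j = 0 then pi else pi / 2))"
    by (simp add: integral_unique if_distrib[of "\<lambda>x. _ * x"] cong: if_cong)
  have "(\<Sum>j\<le>l. (a j)\<^sup>2 * (pi / 2)) \<le> integral {0..pi} (\<lambda>\<theta>. (f \<theta>)\<^sup>2)"
    unfolding I by (intro sum_mono) (simp add: power2_eq_square)
  then have a_le: "(\<Sum>j\<le>l. (a j)\<^sup>2) \<le> 2 / pi * integral {0..pi} (\<lambda>\<theta>. (f \<theta>)\<^sup>2)"
    unfolding sum_distrib_right[symmetric] by (simp add: field_simps)
  have "(f \<theta>)\<^sup>2 \<le> (\<Sum>j\<le>l. (a j)\<^sup>2) * (\<Sum>j\<le>l. (cos (real j * \<theta>))\<^sup>2)"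
    unfolding f_def by (rule Cauchy_Schwarz_ineq_sum)
  also have "\<dots> \<le> (\<Sum>j\<le>l. (a j)\<^sup>2) * (\<Sum>j\<le>l. 1)"
    by (intro mult_left_mono sum_mono sum_nonneg) (auto simp: abs_square_le_1)
  also have "\<dots> \<le> 2 / pi * integral {0..pi} (\<lambda>\<theta>. (f \<theta>)\<^sup>2) * (real l + 1)"
    using mult_right_mono[OF a_le, of "real l + 1"] by (simp add: add.commute)
  finally show ?thesis by (simp add: field_simps)
qed

text \<open>
  Jordan's inequality: the concave function \<open>sin\<close> lies above its chord from \<open>0\<close> to \<open>\<pi> / 2\<close>.
\<close>
lemma two_over_pi_times_le_sin:
  fixes x :: real
  assumes "0 \<le> x" "x \<le> pi / 2"
  shows "2 / pi * x \<le> sin x"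
proof -
  have "convex_on {0..pi} (\<lambda>x. - sin x)"
  proof (rule f''_ge0_imp_convex[of _ _ "\<lambda>x. - cos x" "\<lambda>x. sin x"])
  qed (auto intro!: derivative_eq_intros sin_ge_zero)
  from convex_onD[OF this, of "2 / pi * x" 0 "pi / 2"] assms
  show ?thesis by (simp add: field_simps)
qed

text \<open>
  In the variable \<open>\<theta>\<close> the uniform bound \<open>2 N / \<pi>\<close> times the full integral shows that two end
  intervals of length \<open>\<pi> / (8 N)\<close> carry at most half of the integral. What remains stays away from
  both ends: there \<open>sin \<theta>\<close> is at least \<open>1 / (4 N)\<close>, so that returning from \<open>d\<theta>\<close> to \<open>dt\<close> costs
  only one more factor of order \<open>N\<close>, and \<open>t\<close> is at least \<open>1 / (64 N\<^sup>2)\<close>.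
\<close>
lemma polynomial_endpoint_square_le_integral:
  fixes b :: "nat \<Rightarrow> real" and l :: nat
  defines "r \<equiv> \<lambda>t. \<Sum>k\<le>l. b k * t ^ k"
  shows "(r 0)\<^sup>2 \<le> 16 * (real l + 1)\<^sup>2 * integral {1 / (64 * (real l + 1)\<^sup>2)..1} (\<lambda>t. (r t)\<^sup>2)"
proof -
  define N where "N = real l + 1"
  define \<delta> where "\<delta> = pi / (8 * N)"
  define g where "g = (\<lambda>\<theta>::real. (1 - cos \<theta>) / 2)"
  define I where "I = integral {0..pi} (\<lambda>\<theta>. (r (g \<theta>))\<^sup>2)"
  have N: "N \<ge> 1" by (simp add: N_def)
  have \<delta>: "0 < \<delta>" "\<delta> \<le> pi / 8" using N by (auto simp: \<delta>_def field_simps)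
  obtain a where a: "\<And>\<theta>. r (g \<theta>) = (\<Sum>j\<le>l. a j * cos (real j * \<theta>))"
    using polynomial_cosine_expansion[of b l] unfolding r_def g_def by blast
  have sup_le: "(r (g \<theta>))\<^sup>2 \<le> 2 * N / pi * I" for \<theta>
    unfolding I_def a N_def by (rule cosine_sum_square_le_integral)
  have cont: "continuous_on S (\<lambda>\<theta>. (r (g \<theta>))\<^sup>2)" for S
    unfolding r_def g_def by (auto intro!: continuous_intros)
  have int: "(\<lambda>\<theta>. (r (g \<theta>))\<^sup>2) integrable_on {x..y}" for x y
    by (intro integrable_continuous_real cont)
  have "I = integral {0..\<delta>} (\<lambda>\<theta>. (r (g \<theta>))\<^sup>2) + integral {\<delta>..pi - \<delta>} (\<lambda>\<theta>. (r (g \<theta>))\<^sup>2)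
      + integral {pi - \<delta>..pi} (\<lambda>\<theta>. (r (g \<theta>))\<^sup>2)"
  proof -
    have "I = integral {0..\<delta>} (\<lambda>\<theta>. (r (g \<theta>))\<^sup>2) + integral {\<delta>..pi} (\<lambda>\<theta>. (r (g \<theta>))\<^sup>2)"
      unfolding I_def using \<delta> by (intro Henstock_Kurzweil_Integration.integral_combine[symmetric] int) auto
    moreover have "integral {\<delta>..pi} (\<lambda>\<theta>. (r (g \<theta>))\<^sup>2) = integral {\<delta>..pi - \<delta>} (\<lambda>\<theta>. (r (g \<theta>))\<^sup>2)
      + integral {pi - \<delta>..pi} (\<lambda>\<theta>. (r (g \<theta>))\<^sup>2)"
      using \<delta> by (intro Henstock_Kurzweil_Integration.integral_combine[symmetric] int) auto
    ultimately show ?thesis by simp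
  qed
  moreover have "integral {0..\<delta>} (\<lambda>\<theta>. (r (g \<theta>))\<^sup>2) \<le> I / 4"
  proof -
    have "integral {0..\<delta>} (\<lambda>\<theta>. (r (g \<theta>))\<^sup>2) \<le> integral {0..\<delta>} (\<lambda>\<theta>. 2 * N / pi * I)"
      by (intro integral_le int sup_le) auto
    also have "\<dots> = I / 4" using \<delta> N by (simp add: \<delta>_def field_simps)
    finally show ?thesis .
  qed
  moreover have "integral {pi - \<delta>..pi} (\<lambda>\<theta>. (r (g \<theta>))\<^sup>2) \<le> I / 4"
  proof -
    have "integral {pi - \<delta>..pi} (\<lambda>\<theta>. (r (g \<theta>))\<^sup>2) \<le> integral {pi - \<delta>..pi} (\<lambda>\<theta>. 2 * N / pi * I)"
      by (intro integral_le int sup_le) auto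
    also have "\<dots> = I / 4" using \<delta> N by (simp add: \<delta>_def field_simps)
    finally show ?thesis .
  qed
  ultimately have half: "I \<le> 2 * integral {\<delta>..pi - \<delta>} (\<lambda>\<theta>. (r (g \<theta>))\<^sup>2)" by linarith
  \<comment> \<open>Reflecting at \<open>\<pi> / 2\<close> reduces to angles at which Jordan's inequality applies.\<close>
  have sin_ge: "1 / (4 * N) \<le> sin \<theta>" if "\<theta> \<in> {\<delta>..pi - \<delta>}" for \<theta>
  proof -
    define x where "x = min \<theta> (pi - \<theta>)"
    have x: "\<delta> \<le> x" "x \<le> pi / 2" "sin \<theta> = sin x" using that by (auto simp: x_def min_def)
    have "1 / (4 * N) = 2 / pi * \<delta>" by (simp add: \<delta>_def)
    also have "\<dots> \<le> 2 / pi * x" using x by (intro mult_left_mono) auto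
    also have "\<dots> \<le> sin x" using x \<delta> by (intro two_over_pi_times_le_sin) auto
    finally show ?thesis using x by simp
  qed
  have g_ge: "1 / (64 * N\<^sup>2) \<le> g \<delta>"
  proof -
    have "1 / (8 * N) = 2 / pi * (\<delta> / 2)" by (simp add: \<delta>_def)
    also have "\<dots> \<le> sin (\<delta> / 2)" using \<delta> by (intro two_over_pi_times_le_sin) auto
    finally have "(1 / (8 * N))\<^sup>2 \<le> (sin (\<delta> / 2))\<^sup>2" using N by (intro power_mono) auto
    moreover have "g \<delta> = (sin (\<delta> / 2))\<^sup>2"
      using cos_double_sin[of "\<delta> / 2"] by (simp add: g_def)
    ultimately show ?thesis by (simp add: power_mult_distrib power_divide)
  qed
  have cont_r: "continuous_on S (\<lambda>t. (r t)\<^sup>2)" for S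
    unfolding r_def by (intro continuous_intros)
  have subst: "((\<lambda>\<theta>. (sin \<theta> / 2) *\<^sub>R (r (g \<theta>))\<^sup>2) has_integral
      integral {g \<delta>..g (pi - \<delta>)} (\<lambda>t. (r t)\<^sup>2)) {\<delta>..pi - \<delta>}"
  proof (rule has_integral_substitution[where c = 0 and d = 1 and f = "\<lambda>t. (r t)\<^sup>2"])
    show "\<delta> \<le> pi - \<delta>" using \<delta> by auto
    have "cos \<delta> \<ge> 0" using \<delta> by (intro cos_ge_zero) auto
    then show "g \<delta> \<le> g (pi - \<delta>)" by (simp add: g_def)
    show "g ` {\<delta>..pi - \<delta>} \<subseteq> {0..1}" proof safe
      fix \<theta> :: real
      have "-1 \<le> cos \<theta>" and "cos \<theta> \<le> 1" by simp_all
      then show "g \<theta> \<in> {0..1}" unfolding g_def by simp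
    qed
    fix \<theta> show "(g has_real_derivative sin \<theta> / 2) (at \<theta> within {\<delta>..pi - \<delta>})"
      unfolding g_def by (auto intro!: derivative_eq_intros)
  qed (rule cont_r)
  have "integral {\<delta>..pi - \<delta>} (\<lambda>\<theta>. (r (g \<theta>))\<^sup>2)
      \<le> integral {\<delta>..pi - \<delta>} (\<lambda>\<theta>. 8 * N * ((sin \<theta> / 2) *\<^sub>R (r (g \<theta>))\<^sup>2))"
  proof (intro integral_le int)
    show "(\<lambda>\<theta>. 8 * N * ((sin \<theta> / 2) *\<^sub>R (r (g \<theta>))\<^sup>2)) integrable_on {\<delta>..pi - \<delta>}"
      using has_integral_mult_right[OF subst] by blast
    fix \<theta> assume "\<theta> \<in> {\<delta>..pi - \<delta>}"
    from sin_ge[OF this] N have "1 \<le> 8 * N * (sin \<theta> / 2)" by (simp add: field_simps)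
    then show "(r (g \<theta>))\<^sup>2 \<le> 8 * N * ((sin \<theta> / 2) *\<^sub>R (r (g \<theta>))\<^sup>2)"
      using mult_right_mono[of 1 "8 * N * (sin \<theta> / 2)" "(r (g \<theta>))\<^sup>2"] by simp
  qed
  also have "\<dots> = 8 * N * integral {g \<delta>..g (pi - \<delta>)} (\<lambda>t. (r t)\<^sup>2)"
    by (rule integral_unique[OF has_integral_mult_right[OF subst]])
  also have "\<dots> \<le> 8 * N * integral {1 / (64 * N\<^sup>2)..1} (\<lambda>t. (r t)\<^sup>2)"
  proof (intro mult_left_mono integral_subset_le integrable_continuous_real cont_r)
    have "cos (pi - \<delta>) \<ge> -1" by (rule cos_ge_minus_one)
    then show "{g \<delta>..g (pi - \<delta>)} \<subseteq> {1 / (64 * N\<^sup>2)..1}" using g_ge by (auto simp: g_def)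
  qed (use N in auto)
  finally have kept: "integral {\<delta>..pi - \<delta>} (\<lambda>\<theta>. (r (g \<theta>))\<^sup>2)
      \<le> 8 * N * integral {1 / (64 * N\<^sup>2)..1} (\<lambda>t. (r t)\<^sup>2)" .
  define J where "J = integral {1 / (64 * N\<^sup>2)..1} (\<lambda>t. (r t)\<^sup>2)"
  have J: "J \<ge> 0" unfolding J_def by (rule integral_nonneg) (auto intro: integrable_continuous_real cont_r)
  have "(r 0)\<^sup>2 \<le> 2 * N / pi * I" using sup_le[of 0] by (simp add: g_def)
  also have "\<dots> \<le> 2 * N / pi * (16 * N * J)"
    using half kept N unfolding J_def by (intro mult_left_mono) auto
  also have "\<dots> = 32 / pi * (N\<^sup>2 * J)" by (simp add: power2_eq_square)
  also have "\<dots> \<le> 16 * (N\<^sup>2 * J)"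
    using pi_ge_two J by (intro mult_right_mono) (auto simp: field_simps)
  finally show ?thesis by (simp add: N_def J_def mult.assoc)
qed

section \<open>Polynomials along parabolas\<close>

lemma poly_space_along_polynomial_curve:
  fixes v :: "real ^ 'd::finite \<Rightarrow> real" and f :: "'d \<Rightarrow> real poly"
  assumes v: "v \<in> poly_space l" and deg: "\<And>i. degree (f i) \<le> k"
  shows "\<exists>Q. degree Q \<le> k * l \<and> (\<forall>s. v (\<chi> i. poly (f i) s) = poly Q s)"
proof -
  obtain c where c: "v = (\<lambda>x. \<Sum>e\<in>exponents l. c e * (\<Prod>i\<in>UNIV. x $ i ^ e i))"
    using v by (auto simp: poly_space_def)
  define Q where "Q = (\<Sum>e\<in>exponents l. smult (c e) (\<Prod>i\<in>UNIV. f i ^ e i))"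
  have "degree (smult (c e) (\<Prod>i\<in>UNIV. f i ^ e i)) \<le> k * l" if "e \<in> exponents l" for e
  proof -
    have "degree (smult (c e) (\<Prod>i\<in>UNIV. f i ^ e i)) \<le> degree (\<Prod>i\<in>UNIV. f i ^ e i)"
      by (rule degree_smult_le)
    also have "\<dots> \<le> (\<Sum>i\<in>UNIV. degree (f i ^ e i))"
      using degree_prod_sum_le[of UNIV "\<lambda>i. f i ^ e i"] by (simp add: o_def)
    also have "\<dots> \<le> (\<Sum>i\<in>UNIV. k * e i)"
      using deg by (intro sum_mono order_trans[OF degree_power_le]) simp
    also have "\<dots> \<le> k * l" using that by (simp add: exponents_def flip: sum_distrib_left)
    finally show ?thesis .
  qed
  then have "degree Q \<le> k * l"
    unfolding Q_def by (intro degree_sum_le finite_exponents)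
  moreover have "v (\<chi> i. poly (f i) s) = poly Q s" for s
    by (simp add: c Q_def poly_sum poly_prod)
  ultimately show ?thesis by blast
qed

text \<open>
  The odd powers cancel, so that only \<open>l + 1\<close> coefficients are left although the degree is \<open>2 * l\<close>.
\<close>
lemma even_part_of_polynomial:
  fixes Q :: "real poly"
  assumes "degree Q \<le> 2 * l"
  shows "(poly Q s + poly Q (- s)) / 2 = (\<Sum>j\<le>l. coeff Q (2 * j) * (s\<^sup>2) ^ j)"
proof -
  have "(\<Sum>k\<le>2 * l. c k * s ^ k) + (\<Sum>k\<le>2 * l. c k * (- s) ^ k) = 2 * (\<Sum>j\<le>l. c (2 * j) * (s\<^sup>2) ^ j)"
    for c :: "nat \<Rightarrow> real"
    by (induction l) (simp_all add: power_mult[symmetric] algebra_simps)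
  moreover have "poly Q t = (\<Sum>k\<le>2 * l. coeff Q k * t ^ k)" for t
    unfolding poly_altdef using assms
    by (intro sum.mono_neutral_left) (auto simp: coeff_eq_0)
  ultimately show ?thesis by simp
qed

text \<open>
  Every coordinate of the affine image of the parabola is a quadratic polynomial in \<open>s\<close>, so \<open>v\<close>
  becomes a polynomial of degree at most \<open>2 * l\<close> in \<open>s\<close>. Averaging over the two branches
  brings the degree back to \<open>l\<close>, now in the variable \<open>s\<^sup>2\<close>.
\<close>
lemma poly_space_even_along_parabola:
  fixes v :: "real ^ 'd::finite \<Rightarrow> real" and A :: "real ^ 'd \<Rightarrow> real ^ 'd"
  assumes v: "v \<in> poly_space l" and A: "affine_map A"
  shows "\<exists>b. \<forall>s. (v (A (s *\<^sub>R x + s\<^sup>2 *\<^sub>R y)) + v (A (- s *\<^sub>R x + s\<^sup>2 *\<^sub>R y))) / 2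
     = (\<Sum>j\<le>l. b j * (s\<^sup>2) ^ j)"
proof -
  obtain L a where L: "linear L" and A_eq: "A = (\<lambda>x. L x + a)"
    using A by (auto simp: affine_map_def)
  define f where "f i = [: a $ i, L x $ i, L y $ i :]" for i
  have "degree (f i) \<le> 2" for i by (simp add: f_def)
  from poly_space_along_polynomial_curve[OF v, of f, OF this]
  obtain Q where Q: "degree Q \<le> 2 * l" "\<And>s. v (\<chi> i. poly (f i) s) = poly Q s" by blast
  have "A (s *\<^sub>R x + s\<^sup>2 *\<^sub>R y) = (\<chi> i. poly (f i) s)" for s
    by (simp add: A_eq f_def vec_eq_iff linear_add[OF L] linear_scale[OF L] power2_eq_square algebra_simps)
  then have "v (A (s *\<^sub>R x + s\<^sup>2 *\<^sub>R y)) = poly Q s" for s by (simp add: Q)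
  from this this[of "- s" for s] show ?thesis
    using even_part_of_polynomial[OF Q(1)] by (intro exI[of _ "\<lambda>j. coeff Q (2 * j)"]) simp
qed

lemma continuous_on_poly_space:
  assumes "v \<in> poly_space l"
  shows "continuous_on S v"
proof -
  obtain c where "v = (\<lambda>x. \<Sum>e\<in>exponents l. c e * (\<Prod>i\<in>UNIV. x $ i ^ e i))"
    using assms by (auto simp: poly_space_def)
  then show ?thesis by (auto intro!: continuous_intros)
qed

section \<open>Linear substitutions in Lebesgue integrals\<close>

lemma nn_integral_lborel_translate:
  fixes f :: "'a::euclidean_space \<Rightarrow> ennreal"
  assumes [measurable]: "f \<in> borel_measurable borel"
  shows "(\<integral>\<^sup>+x. f (x - a) \<partial>lborel) = (\<integral>\<^sup>+x. f x \<partial>lborel)"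
proof -
  have "(\<integral>\<^sup>+x. f x \<partial>lborel) = (\<integral>\<^sup>+x. f x \<partial>distr lborel borel ((+) (- a)))"
    by (simp only: lborel_distr_plus)
  also have "\<dots> = (\<integral>\<^sup>+x. f (x - a) \<partial>lborel)"
    by (subst nn_integral_distr) simp_all
  finally show ?thesis by simp
qed

lemma nn_integral_lborel_reflect:
  fixes f :: "'a::euclidean_space \<Rightarrow> ennreal"
  assumes [measurable]: "f \<in> borel_measurable borel"
  shows "(\<integral>\<^sup>+x. f (a - x) \<partial>lborel) = (\<integral>\<^sup>+x. f x \<partial>lborel)"
proof -
  have "distr lborel borel (\<lambda>x. a - x) = lborel"
    using lborel_affine[of "- 1" a] by (simp add: density_1)
  then have "(\<integral>\<^sup>+x. f x \<partial>lborel) = (\<integral>\<^sup>+x. f x \<partial>distr lborel borel (\<lambda>x. a - x))"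
    by simp
  also have "\<dots> = (\<integral>\<^sup>+x. f (a - x) \<partial>lborel)"
    by (subst nn_integral_distr) simp_all
  finally show ?thesis by simp
qed

text \<open>
  The functional \<open>g \<mapsto> \<integral> g (L w)\<close> is invariant under translations, hence proportional to the Lebesgue
  integral. The proof is the usual one for the uniqueness of Haar measure, by evaluating the double
  integral of \<open>g (L w - x) * f x\<close> in two ways. The symmetric form avoids naming the factor
  of proportionality, which is the inverse of the absolute value of the determinant.
\<close>
lemma nn_integral_linear_proportional:
  fixes L :: "'a::euclidean_space \<Rightarrow> 'a" and f g :: "'a \<Rightarrow> ennreal"
  assumes L: "linear L" "inj L"
    and [measurable]: "f \<in> borel_measurable borel" "g \<in> borel_measurable borel"
  shows "(\<integral>\<^sup>+w. g (L w) \<partial>lborel) * (\<integral>\<^sup>+x. f x \<partial>lborel)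
       = (\<integral>\<^sup>+x. g x \<partial>lborel) * (\<integral>\<^sup>+w. f (L w) \<partial>lborel)"
proof -
  have L_meas [measurable]: "L \<in> borel_measurable borel"
    using L(1) by (intro borel_measurable_continuous_onI linear_continuous_on) (simp add: linear_conv_bounded_linear)
  have shift: "(\<integral>\<^sup>+w. k (L w - x) \<partial>lborel) = (\<integral>\<^sup>+w. k (L w) \<partial>lborel)"
    if [measurable]: "k \<in> borel_measurable borel" for k :: "'a \<Rightarrow> ennreal" and x
  proof -
    obtain u where "L u = x"
      using linear_injective_imp_surjective[OF L] by (metis surjD)
    then have "L w - x = L (w - u)" for w by (simp add: linear_diff[OF L(1)])
    then show ?thesis
      using nn_integral_lborel_translate[of "\<lambda>w. k (L w)" u] by simp
  qed
  have "(\<integral>\<^sup>+w. g (L w) \<partial>lborel) * (\<integral>\<^sup>+x. f x \<partial>lborel)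
      = (\<integral>\<^sup>+x. (\<integral>\<^sup>+w. g (L w) \<partial>lborel) * f x \<partial>lborel)"
    by (simp add: nn_integral_cmult)
  also have "\<dots> = (\<integral>\<^sup>+x. (\<integral>\<^sup>+w. g (L w - x) * f x \<partial>lborel) \<partial>lborel)"
    by (simp add: shift nn_integral_multc)
  also have "\<dots> = (\<integral>\<^sup>+w. (\<integral>\<^sup>+x. g (L w - x) * f x \<partial>lborel) \<partial>lborel)"
    by (rule lborel_pair.Fubini') measurable
  also have "\<dots> = (\<integral>\<^sup>+w. (\<integral>\<^sup>+x. g x * f (L w - x) \<partial>lborel) \<partial>lborel)"
  \<comment> \<open>The substitution of \<open>L w - x\<close> for \<open>x\<close> exchanges the arguments of \<open>f\<close> and \<open>g\<close>.\<close>
  proof (rule nn_integral_cong)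
    fix w show "(\<integral>\<^sup>+x. g (L w - x) * f x \<partial>lborel) = (\<integral>\<^sup>+x. g x * f (L w - x) \<partial>lborel)"
      using nn_integral_lborel_reflect[of "\<lambda>x. g x * f (L w - x)" "L w"] by simp
  qed
  also have "\<dots> = (\<integral>\<^sup>+x. (\<integral>\<^sup>+w. g x * f (L w - x) \<partial>lborel) \<partial>lborel)"
    by (rule lborel_pair.Fubini') measurable
  also have "\<dots> = (\<integral>\<^sup>+x. g x * (\<integral>\<^sup>+w. f (L w) \<partial>lborel) \<partial>lborel)"
    by (simp add: shift nn_integral_cmult)
  also have "\<dots> = (\<integral>\<^sup>+x. g x \<partial>lborel) * (\<integral>\<^sup>+w. f (L w) \<partial>lborel)"
    by (simp add: nn_integral_multc)
  finally show ?thesis .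
qed

lemma nn_integral_diagonal:
  fixes c :: "'d::finite \<Rightarrow> real" and f :: "real ^ 'd \<Rightarrow> ennreal"
  assumes c: "\<And>i. c i \<noteq> 0" and f [measurable]: "f \<in> borel_measurable borel"
  shows "(\<integral>\<^sup>+x. f x \<partial>lborel) = ennreal (\<Prod>i\<in>UNIV. \<bar>c i\<bar>) * (\<integral>\<^sup>+x. f (\<chi> i. c i * x $ i) \<partial>lborel)"
proof -
  \<comment> \<open>The factor belonging to the basis vector \<open>axis i 1\<close> is \<open>c i\<close>.\<close>
  define c' where "c' b = (\<Sum>i\<in>UNIV. c i * b $ i)" for b :: "real ^ 'd"
  have c'_axis: "c' (axis i 1) = c i" for i
    by (simp add: c'_def axis_def if_distrib[of "\<lambda>x. _ * x"] cong: if_cong)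
  have Basis_eq: "(Basis :: (real ^ 'd) set) = range (\<lambda>i. axis i 1)"
    by (auto simp: Basis_vec_def)
  have inj: "inj (\<lambda>i::'d. axis i (1::real))"
    by (auto simp: inj_on_def axis_eq_axis)
  define T where "T x = 0 + (\<Sum>j\<in>Basis. (c' j * (x \<bullet> j)) *\<^sub>R j)" for x :: "real ^ 'd"
  have T: "T x = (\<chi> i. c i * x $ i)" for x
    unfolding T_def Basis_eq
    by (subst sum.reindex[OF inj])
       (simp add: vec_eq_iff c'_axis inner_axis, simp add: axis_def if_distrib[of "\<lambda>x. _ * x"] cong: if_cong)
  have prod: "(\<Prod>j\<in>Basis. \<bar>c' j\<bar>) = (\<Prod>i\<in>UNIV. \<bar>c i\<bar>)"
    unfolding Basis_eq by (subst prod.reindex[OF inj]) (simp add: c'_axis)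
  have T_meas [measurable]: "T \<in> borel \<rightarrow>\<^sub>M borel"
    unfolding T_def by measurable
  have "lborel = density (distr lborel borel T) (\<lambda>_. ennreal (\<Prod>j\<in>Basis. \<bar>c' j\<bar>))"
    unfolding T_def by (rule lborel_affine_euclidean) (use c in \<open>auto simp: Basis_eq c'_axis\<close>)
  then have "(\<integral>\<^sup>+x. f x \<partial>lborel) =
      (\<integral>\<^sup>+x. f x \<partial>density (distr lborel borel T) (\<lambda>_. ennreal (\<Prod>j\<in>Basis. \<bar>c' j\<bar>)))"
    by (rule arg_cong)
  also have "\<dots> = ennreal (\<Prod>i\<in>UNIV. \<bar>c i\<bar>) * (\<integral>\<^sup>+x. f (T x) \<partial>lborel)"
    by (simp add: nn_integral_density nn_integral_distr nn_integral_cmult prod)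
  finally show ?thesis by (simp add: T)
qed

section \<open>Averages over parabolic dilations\<close>

lemma mem_reference_domain_iff:
  "x \<in> reference_domain z \<alpha> \<longleftrightarrow>
     (\<forall>i. \<bar>x $ i\<bar> \<le> 1) \<and> 0 \<le> x $ z \<and> (\<forall>i. i \<noteq> z \<longrightarrow> \<bar>x $ i\<bar> powr \<alpha> i \<le> x $ z)"
  by (auto simp: reference_domain_def abs_le_iff minus_le_iff)

lemma compact_reference_domain:
  fixes z :: "'d::finite"
  assumes "\<And>i. i \<noteq> z \<Longrightarrow> 0 < \<alpha> i"
  shows "compact (reference_domain z \<alpha>)"
proof -
  have "reference_domain z \<alpha> = cbox (- 1) 1 \<inter> {x. 0 \<le> x $ z} \<inter> (\<Inter>i\<in>- {z}. {x. \<bar>x $ i\<bar> powr \<alpha> i \<le> x $ z})"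
    by (auto simp: set_eq_iff mem_reference_domain_iff mem_box_cart abs_le_iff minus_le_iff)
  moreover have coordinate: "closed {x :: real ^ 'd. \<bar>x $ i\<bar> powr \<alpha> i \<le> x $ z}" if "i \<noteq> z" for i
    by (intro closed_Collect_le continuous_on_powr' continuous_intros) (use assms that in auto)
  ultimately show ?thesis
    by (auto intro!: compact_Int_closed closed_INT coordinate closed_Collect_le[of "\<lambda>_. 0"] continuous_intros
        simp del: abs_le_zero_iff)
qed

lemma reference_domain_subset_cbox: "reference_domain z \<alpha> \<subseteq> cbox (- 1) 1"
  by (auto simp: mem_reference_domain_iff mem_box_cart abs_le_iff minus_le_iff)

text \<open>
  For fixed \<open>x\<close>, the images for \<open>\<sigma> = 1\<close> and \<open>\<sigma> = - 1\<close> run through the two branches of a parabola with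
  apex \<open>0\<close>, parametrised by \<open>\<tau>\<close>; for fixed \<open>\<tau> > 0\<close> the map is linear and diagonal.
\<close>
definition parabolic_dilation ::
  "'d::finite \<Rightarrow> ('d \<Rightarrow> real) \<Rightarrow> real \<Rightarrow> real \<Rightarrow> real ^ 'd \<Rightarrow> real ^ 'd" where
  "parabolic_dilation z h \<sigma> \<tau> x = (\<chi> i. (if i = z then \<tau> else \<sigma> * h i * sqrt \<tau>) * x $ i)"

lemma parabolic_dilation_measurable [measurable]:
  "(\<lambda>(x, \<tau>). parabolic_dilation z h \<sigma> \<tau> x) \<in> borel_measurable (borel \<Otimes>\<^sub>M borel)"
proof -
  have "continuous_on UNIV (\<lambda>p. parabolic_dilation z h \<sigma> (snd p) (fst p))"
    unfolding parabolic_dilation_def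
  proof (rule continuous_on_vec_lambda)
    show "continuous_on UNIV (\<lambda>p. (if i = z then snd p else \<sigma> * h i * sqrt (snd p)) * fst p $ i)" for i
      by (cases "i = z") (auto intro!: continuous_intros)
  qed
  then show ?thesis
    unfolding borel_prod split_beta' by (rule borel_measurable_continuous_onI)
qed

text \<open>
  The parabolas used in the average are indexed by the points of this box. The last coordinate is
  bounded below so that a point of the form \<open>parabolic_dilation z h \<sigma> \<tau> x\<close> determines \<open>\<tau>\<close> up to a factor \<open>2\<close>.
\<close>
definition dilation_box :: "'d::finite \<Rightarrow> (real ^ 'd) set" where
  "dilation_box z = cbox (\<chi> i. if i = z then 1 / 2 else 0) 1"

lemma emeasure_dilation_box:
  fixes z :: "'d::finite"
  shows "emeasure lborel (dilation_box z) = ennreal (1 / 2)"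
proof -
  have "measure lborel (dilation_box z)
      = (\<Prod>i\<in>UNIV. (1 :: real ^ 'd) $ i - (\<chi> i. if i = z then 1 / 2 else 0) $ i)"
    unfolding dilation_box_def by (intro content_cbox_cart) (auto simp: interval_ne_empty_cart)
  also have "\<dots> = (\<Prod>i\<in>UNIV. if i = z then 1 / 2 else 1)"
    by (intro prod.cong) auto
  finally have half: "measure lborel (dilation_box z) = 1 / 2" by simp
  have "emeasure lborel (dilation_box z) \<noteq> top"
    using emeasure_lborel_cbox_finite[of "\<chi> i. if i = z then 1 / 2 else 0" "1 :: real ^ 'd"]
    by (auto simp: dilation_box_def)
  then show ?thesis
    using emeasure_eq_ennreal_measure[of lborel "dilation_box z"] unfolding half by blast
qed

text \<open>
  For \<open>t > 0\<close> the integrand is at most \<open>1 / t\<close> on an interval of length \<open>t\<close>, and zero elsewhere.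
\<close>
lemma nn_integral_inverse_dyadic:
  fixes t :: real
  shows "(\<integral>\<^sup>+\<tau>. ennreal (1 / \<tau>) * indicator {\<tau>. 0 < \<tau> \<and> \<tau> / 2 \<le> t \<and> t \<le> \<tau>} \<tau> \<partial>lborel) \<le> 1"
proof (cases "t > 0")
  case True
  have "(\<integral>\<^sup>+\<tau>. ennreal (1 / \<tau>) * indicator {\<tau>. 0 < \<tau> \<and> \<tau> / 2 \<le> t \<and> t \<le> \<tau>} \<tau> \<partial>lborel)
      \<le> (\<integral>\<^sup>+\<tau>. ennreal (1 / t) * indicator {t..2 * t} \<tau> \<partial>lborel)"
    using True by (intro nn_integral_mono) (auto simp: indicator_def frac_le intro!: ennreal_leI)
  also have "\<dots> = ennreal (1 / t) * ennreal t"
    using True by (simp add: nn_integral_cmult)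
  also have "\<dots> = 1" using True by (simp flip: ennreal_mult)
  finally show ?thesis .
next
  case False
  then have "(\<integral>\<^sup>+\<tau>. ennreal (1 / \<tau>) * indicator {\<tau>. 0 < \<tau> \<and> \<tau> / 2 \<le> t \<and> t \<le> \<tau>} \<tau> \<partial>lborel)
      = (\<integral>\<^sup>+\<tau>. 0 \<partial>(lborel :: real measure))"
    by (intro nn_integral_cong) (auto simp: indicator_def)
  then show ?thesis by simp
qed

text \<open>
  For fixed \<open>\<tau>\<close> the change of variables \<open>y = parabolic_dilation z h \<sigma> \<tau> x\<close> has Jacobian \<open>\<tau>\<close> times
  the product of the numbers \<open>h i * sqrt \<tau>\<close>, each of which is at least \<open>h i * sqrt \<epsilon>\<close>. The remaining
  factor \<open>1 / \<tau>\<close> is exactly what the integral over the dyadic range of \<open>\<tau>\<close> belonging to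
  \<open>y\<close> absorbs; this is why no logarithm of \<open>\<epsilon>\<close> appears.
\<close>
lemma dilation_average_le:
  fixes z :: "'d::finite" and g :: "real ^ 'd \<Rightarrow> ennreal"
  assumes \<epsilon>: "0 < \<epsilon>" and h: "\<And>i. i \<noteq> z \<Longrightarrow> 0 < h i" and \<sigma>: "\<bar>\<sigma>\<bar> = 1"
    and g [measurable]: "g \<in> borel_measurable borel"
    and R [measurable]: "R \<in> sets borel"
    and sub: "\<And>x \<tau>. x \<in> dilation_box z \<Longrightarrow> \<tau> \<in> {\<epsilon>..1} \<Longrightarrow> parabolic_dilation z h \<sigma> \<tau> x \<in> R"
  shows "(\<integral>\<^sup>+x. (\<integral>\<^sup>+\<tau>. g (parabolic_dilation z h \<sigma> \<tau> x) * indicator {\<epsilon>..1} \<tau> \<partial>lborel)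
            * indicator (dilation_box z) x \<partial>lborel)
     \<le> ennreal (1 / (\<Prod>i\<in>- {z}. h i * sqrt \<epsilon>)) * (\<integral>\<^sup>+y. g y * indicator R y \<partial>lborel)"
proof -
  let ?\<delta> = "\<lambda>\<tau>. parabolic_dilation z h \<sigma> \<tau>"
  let ?T = "\<lambda>y. {\<tau>. 0 < \<tau> \<and> \<tau> / 2 \<le> y $ z \<and> y $ z \<le> \<tau>}"
  define H where "H = (\<Prod>i\<in>- {z}. h i * sqrt \<epsilon>)"
  have H: "H > 0" unfolding H_def using h \<epsilon> by (intro prod_pos) auto
  have box_borel [measurable]: "dilation_box z \<in> sets borel" by (simp add: dilation_box_def)
  have coord_borel [measurable]: "(\<lambda>y :: real ^ 'd. y $ z) \<in> borel_measurable borel"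
    by (intro borel_measurable_continuous_onI continuous_intros)
  have z_coordinate: "?\<delta> \<tau> x $ z = \<tau> * x $ z" for \<tau> x by (simp add: parabolic_dilation_def)
  have jacobian: "(\<integral>\<^sup>+x. G (?\<delta> \<tau> x) \<partial>lborel) \<le> ennreal (1 / H) * ennreal (1 / \<tau>) * (\<integral>\<^sup>+y. G y \<partial>lborel)"
    if \<tau>: "\<epsilon> \<le> \<tau>" and G [measurable]: "G \<in> borel_measurable borel" for \<tau> and G :: "real ^ 'd \<Rightarrow> ennreal"
  proof -
    define c where "c i = (if i = z then \<tau> else \<sigma> * h i * sqrt \<tau>)" for i
    define J where "J = (\<Prod>i\<in>UNIV. \<bar>c i\<bar>)"
    have c: "c i \<noteq> 0" for i using \<tau> \<epsilon> h[of i] \<sigma> by (auto simp: c_def)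
    have J_eq: "J = \<bar>c z\<bar> * (\<Prod>i\<in>- {z}. \<bar>c i\<bar>)"
      unfolding J_def by (subst prod.remove[of _ z]) (auto simp: Compl_eq_Diff_UNIV)
    have H_le: "H \<le> (\<Prod>i\<in>- {z}. \<bar>c i\<bar>)"
      unfolding H_def
    proof (intro prod_mono conjI)
      fix i assume "i \<in> - {z}"
      then show "0 \<le> h i * sqrt \<epsilon>" "h i * sqrt \<epsilon> \<le> \<bar>c i\<bar>"
        using h[of i] \<tau> \<epsilon> \<sigma> by (auto simp: c_def abs_mult intro!: mult_left_mono)
    qed
    have J: "\<tau> * H \<le> J"
      unfolding J_eq using \<tau> \<epsilon> H_le by (intro mult_mono) (use H in \<open>auto simp: c_def\<close>)
    have "ennreal (H * \<tau>) * (\<integral>\<^sup>+x. G (?\<delta> \<tau> x) \<partial>lborel) \<le> ennreal J * (\<integral>\<^sup>+x. G (?\<delta> \<tau> x) \<partial>lborel)"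
      using J by (intro mult_right_mono ennreal_leI) (auto simp: mult.commute)
    also have "\<dots> = (\<integral>\<^sup>+y. G y \<partial>lborel)"
      using nn_integral_diagonal[of c G] c G by (simp add: J_def c_def parabolic_dilation_def)
    finally have "ennreal (1 / (H * \<tau>)) * (ennreal (H * \<tau>) * (\<integral>\<^sup>+x. G (?\<delta> \<tau> x) \<partial>lborel))
        \<le> ennreal (1 / (H * \<tau>)) * (\<integral>\<^sup>+y. G y \<partial>lborel)" by (rule mult_left_mono) simp
    moreover have "ennreal (1 / (H * \<tau>)) * ennreal (H * \<tau>) = 1"
      using H \<tau> \<epsilon> by (simp flip: ennreal_mult)
    moreover have "ennreal (1 / (H * \<tau>)) = ennreal (1 / H) * ennreal (1 / \<tau>)"
      using H \<tau> \<epsilon> by (simp flip: ennreal_mult)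
    ultimately show ?thesis by (simp flip: mult.assoc)
  qed
  have "(\<integral>\<^sup>+x. (\<integral>\<^sup>+\<tau>. g (?\<delta> \<tau> x) * indicator {\<epsilon>..1} \<tau> \<partial>lborel) * indicator (dilation_box z) x \<partial>lborel)
      = (\<integral>\<^sup>+x. (\<integral>\<^sup>+\<tau>. g (?\<delta> \<tau> x) * indicator {\<epsilon>..1} \<tau> * indicator (dilation_box z) x \<partial>lborel) \<partial>lborel)"
    by (intro nn_integral_cong nn_integral_multc[symmetric]) measurable
  also have "\<dots> = (\<integral>\<^sup>+\<tau>. (\<integral>\<^sup>+x. g (?\<delta> \<tau> x) * indicator {\<epsilon>..1} \<tau> * indicator (dilation_box z) x \<partial>lborel) \<partial>lborel)"
    by (rule lborel_pair.Fubini'[symmetric]) measurable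
  also have "\<dots> \<le> (\<integral>\<^sup>+\<tau>. ennreal (1 / H) *
      (\<integral>\<^sup>+y. g y * indicator R y * (ennreal (1 / \<tau>) * indicator (?T y) \<tau>) \<partial>lborel) \<partial>lborel)"
  proof (rule nn_integral_mono)
    fix \<tau> :: real
    \<comment> \<open>The second indicator records that the image of the box lies between the heights \<open>\<tau> / 2\<close> and \<open>\<tau>\<close>.\<close>
    define G where "G y = g y * indicator R y * indicator {y. \<tau> / 2 \<le> y $ z \<and> y $ z \<le> \<tau>} y"
      for y :: "real ^ 'd"
    have [measurable]: "G \<in> borel_measurable borel" unfolding G_def by measurable
    show "(\<integral>\<^sup>+x. g (?\<delta> \<tau> x) * indicator {\<epsilon>..1} \<tau> * indicator (dilation_box z) x \<partial>lborel)
        \<le> ennreal (1 / H) *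
          (\<integral>\<^sup>+y. g y * indicator R y * (ennreal (1 / \<tau>) * indicator (?T y) \<tau>) \<partial>lborel)"
    proof (cases "\<tau> \<in> {\<epsilon>..1}")
      case True
      then have \<tau>: "\<epsilon> \<le> \<tau>" "0 < \<tau>" using \<epsilon> by auto
      have "(\<integral>\<^sup>+x. g (?\<delta> \<tau> x) * indicator {\<epsilon>..1} \<tau> * indicator (dilation_box z) x \<partial>lborel)
          \<le> (\<integral>\<^sup>+x. G (?\<delta> \<tau> x) \<partial>lborel)"
      proof (rule nn_integral_mono)
        fix x :: "real ^ 'd"
        show "g (?\<delta> \<tau> x) * indicator {\<epsilon>..1} \<tau> * indicator (dilation_box z) x \<le> G (?\<delta> \<tau> x)"
        proof (cases "x \<in> dilation_box z")
          case x: True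
          then have "1 / 2 \<le> x $ z" "x $ z \<le> 1"
            by (auto simp: dilation_box_def mem_box_cart dest!: spec[of _ z])
          then have "\<tau> / 2 \<le> \<tau> * x $ z" "\<tau> * x $ z \<le> \<tau>"
            using \<tau> mult_left_mono[of "1 / 2" "x $ z" \<tau>] mult_left_mono[of "x $ z" 1 \<tau>] by auto
          then show ?thesis using x True sub[OF x True] by (simp add: G_def z_coordinate)
        qed simp
      qed
      also have "\<dots> \<le> ennreal (1 / H) * ennreal (1 / \<tau>) * (\<integral>\<^sup>+y. G y \<partial>lborel)"
        by (rule jacobian) (use \<tau> in simp_all)
      also have "\<dots> = ennreal (1 / H) * (\<integral>\<^sup>+y. ennreal (1 / \<tau>) * G y \<partial>lborel)"
        by (simp add: nn_integral_cmult mult.assoc)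
      also have "(\<integral>\<^sup>+y. ennreal (1 / \<tau>) * G y \<partial>lborel)
          = (\<integral>\<^sup>+y. g y * indicator R y * (ennreal (1 / \<tau>) * indicator (?T y) \<tau>) \<partial>lborel)"
        using \<tau> by (intro nn_integral_cong) (simp add: G_def indicator_def mult_ac)
      finally show ?thesis .
    qed simp
  qed
  also have "\<dots> = ennreal (1 / H) *
      (\<integral>\<^sup>+\<tau>. (\<integral>\<^sup>+y. g y * indicator R y * (ennreal (1 / \<tau>) * indicator (?T y) \<tau>) \<partial>lborel) \<partial>lborel)"
    by (intro nn_integral_cmult) measurable
  also have "(\<integral>\<^sup>+\<tau>. (\<integral>\<^sup>+y. g y * indicator R y * (ennreal (1 / \<tau>) * indicator (?T y) \<tau>) \<partial>lborel) \<partial>lborel)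
      = (\<integral>\<^sup>+y. (\<integral>\<^sup>+\<tau>. g y * indicator R y * (ennreal (1 / \<tau>) * indicator (?T y) \<tau>) \<partial>lborel) \<partial>lborel)"
    by (rule lborel_pair.Fubini') measurable
  also have "\<dots> = (\<integral>\<^sup>+y. g y * indicator R y * (\<integral>\<^sup>+\<tau>. ennreal (1 / \<tau>) * indicator (?T y) \<tau> \<partial>lborel) \<partial>lborel)"
    by (intro nn_integral_cong nn_integral_cmult) measurable
  also have "\<dots> \<le> (\<integral>\<^sup>+y. g y * indicator R y * 1 \<partial>lborel)"
    by (intro nn_integral_mono mult_left_mono nn_integral_inverse_dyadic) simp
  finally show ?thesis by (simp add: H_def mult_left_mono)
qed

section \<open>The reference domain at its cusp\<close>

text \<open>
  The estimate at the cusp: the one-dimensional inequality holds along the parabola of every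
  point of the box, and \<open>dilation_average_le\<close> bounds its average over the box, whose volume is
  \<open>1 / 2\<close>, by an integral over the reference domain. For polynomials \<open>w\<close> of degree at most \<open>l\<close> the hypothesis on even parts holds by
  \<open>poly_space_even_along_parabola\<close>.
\<close>
lemma reference_domain_square_le_nn_integral:
  fixes z :: "'d::finite" and \<alpha> :: "'d \<Rightarrow> real" and w :: "real ^ 'd \<Rightarrow> real"
  assumes \<alpha>: "\<And>i. i \<noteq> z \<Longrightarrow> 0 < \<alpha> i \<and> \<alpha> i \<le> 2"
    and w: "continuous_on UNIV w"
    and even: "\<And>x y. \<exists>b. \<forall>s. (w (s *\<^sub>R x + s\<^sup>2 *\<^sub>R y) + w (- s *\<^sub>R x + s\<^sup>2 *\<^sub>R y)) / 2
                 = (\<Sum>j\<le>l. b j * (s\<^sup>2) ^ j)"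
  shows "ennreal ((w 0)\<^sup>2) \<le>
     ennreal (32 * (real l + 1)\<^sup>2 * (\<Prod>i\<in>- {z}. (128 * (real l + 1)\<^sup>2) powr (1 / \<alpha> i))) *
     (\<integral>\<^sup>+x. ennreal ((w x)\<^sup>2) * indicator (reference_domain z \<alpha>) x \<partial>lborel)"
proof -
  define N where "N = real l + 1"
  define \<epsilon> where "\<epsilon> = 1 / (64 * N\<^sup>2)"
  \<comment> \<open>With this width, \<open>(h i * sqrt \<tau>) powr \<alpha> i\<close> equals \<open>\<tau> / 2\<close>, the least height of the box after dilation, at \<open>\<tau> = \<epsilon>\<close>.\<close>
  define h where "h i = (\<epsilon> / 2) powr (1 / \<alpha> i) / sqrt \<epsilon>" for i
  define B where "B = dilation_box z"
  have N: "1 \<le> N" by (simp add: N_def)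
  then have "1 \<le> N\<^sup>2" by (rule one_le_power)
  then have \<epsilon>: "0 < \<epsilon>" "\<epsilon> \<le> 1"
    unfolding \<epsilon>_def by (intro divide_pos_pos divide_le_eq_1_pos[THEN iffD2]; linarith)+
  have h: "0 < h i" for i using \<epsilon> by (simp add: h_def)
  have h_sqrt: "h i * sqrt \<epsilon> = (\<epsilon> / 2) powr (1 / \<alpha> i)" for i
    using \<epsilon> by (simp add: h_def)
  let ?\<delta> = "\<lambda>\<sigma> \<tau>. parabolic_dilation z h \<sigma> \<tau>"
  let ?g = "\<lambda>y. ennreal ((w y)\<^sup>2)"
  have [measurable]: "w \<in> borel_measurable borel"
    using w by (rule borel_measurable_continuous_onI)
  have [measurable]: "reference_domain z \<alpha> \<in> sets borel"
    by (intro borel_compact compact_reference_domain) (use \<alpha> in auto)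
  have [measurable]: "B \<in> sets borel" by (simp add: B_def dilation_box_def)
  have sub: "?\<delta> \<sigma> \<tau> x \<in> reference_domain z \<alpha>"
    if \<sigma>: "\<bar>\<sigma>\<bar> = 1" and x: "x \<in> B" and \<tau>: "\<tau> \<in> {\<epsilon>..1}" for \<sigma> \<tau> x
  proof -
    have x_coord: "0 \<le> x $ i" "x $ i \<le> 1" "1 / 2 \<le> x $ z" for i
      using x by (auto simp: B_def dilation_box_def mem_box_cart dest!: spec[of _ i] split: if_splits)
    have z_coord: "?\<delta> \<sigma> \<tau> x $ z = \<tau> * x $ z" by (simp add: parabolic_dilation_def)
    have z_ge: "\<tau> / 2 \<le> \<tau> * x $ z" using mult_left_mono[of "1 / 2" "x $ z" \<tau>] x_coord(3) \<tau> \<epsilon> by auto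
    have z_le: "\<tau> * x $ z \<le> 1" using mult_mono[of \<tau> 1 "x $ z" 1] x_coord(1,2)[of z] \<tau> \<epsilon> by auto
    have side: "\<bar>?\<delta> \<sigma> \<tau> x $ i\<bar> powr \<alpha> i \<le> \<tau> / 2" if i: "i \<noteq> z" for i
    proof -
      have "\<bar>?\<delta> \<sigma> \<tau> x $ i\<bar> = h i * sqrt \<tau> * x $ i"
        using i \<sigma> h[of i] \<tau> \<epsilon> x_coord(1) by (simp add: parabolic_dilation_def abs_mult)
      also have "\<dots> \<le> h i * sqrt \<tau> * 1"
        using h[of i] \<tau> \<epsilon> x_coord(2) by (intro mult_left_mono) auto
      also have "\<dots> = (\<epsilon> / 2) powr (1 / \<alpha> i) * (\<tau> / \<epsilon>) powr (1 / 2)"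
        using \<tau> \<epsilon> by (simp add: h_def real_sqrt_divide powr_half_sqrt)
      finally have "\<bar>?\<delta> \<sigma> \<tau> x $ i\<bar> powr \<alpha> i
          \<le> ((\<epsilon> / 2) powr (1 / \<alpha> i) * (\<tau> / \<epsilon>) powr (1 / 2)) powr \<alpha> i"
        using \<alpha>[OF i] by (intro powr_mono2) auto
      also have "\<dots> = \<epsilon> / 2 * (\<tau> / \<epsilon>) powr (\<alpha> i / 2)"
        using \<alpha>[OF i] \<epsilon> \<tau> by (simp add: powr_mult powr_powr)
      \<comment> \<open>Here \<open>\<alpha> i \<le> 2\<close> and \<open>\<tau> \<ge> \<epsilon>\<close> enter: the parabolas stay inside the domain once \<open>\<tau>\<close> has passed \<open>\<epsilon>\<close>.\<close>
      also have "\<dots> \<le> \<epsilon> / 2 * (\<tau> / \<epsilon>) powr 1"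
        using \<alpha>[OF i] \<epsilon> \<tau> by (intro mult_left_mono powr_mono) auto
      also have "\<dots> = \<tau> / 2" using \<epsilon> \<tau> by simp
      finally show ?thesis .
    qed
    have "\<bar>?\<delta> \<sigma> \<tau> x $ i\<bar> \<le> 1" for i
    proof (cases "i = z")
      case True
      then show ?thesis using z_coord z_ge z_le \<tau> \<epsilon> by auto
    next
      case False
      have "\<bar>?\<delta> \<sigma> \<tau> x $ i\<bar> powr \<alpha> i \<le> 1 powr \<alpha> i" using side[OF False] \<tau> by auto
      then show ?thesis using \<alpha>[OF False] powr_less_mono2[of "\<alpha> i" 1 "\<bar>?\<delta> \<sigma> \<tau> x $ i\<bar>"]
        by (meson abs_ge_zero not_le zero_le_one)
    qed
    moreover have "0 \<le> \<tau> * x $ z" using z_ge \<tau> \<epsilon> by auto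
    moreover have "\<bar>?\<delta> \<sigma> \<tau> x $ i\<bar> powr \<alpha> i \<le> \<tau> * x $ z" if "i \<noteq> z" for i
      using side[OF that] z_ge by linarith
    ultimately show ?thesis by (simp add: mem_reference_domain_iff z_coord)
  qed
  have pointwise: "?g 0 \<le> ennreal (8 * N\<^sup>2) *
      ((\<integral>\<^sup>+\<tau>. ?g (?\<delta> 1 \<tau> x) * indicator {\<epsilon>..1} \<tau> \<partial>lborel)
       + (\<integral>\<^sup>+\<tau>. ?g (?\<delta> (- 1) \<tau> x) * indicator {\<epsilon>..1} \<tau> \<partial>lborel))" for x
  proof -
    define X where "X = (\<chi> i. if i = z then 0 else h i * x $ i)"
    define Y where "Y = (\<chi> i. if i = z then x $ z else 0)"
    obtain b where b: "\<And>s. (w (s *\<^sub>R X + s\<^sup>2 *\<^sub>R Y) + w (- s *\<^sub>R X + s\<^sup>2 *\<^sub>R Y)) / 2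
        = (\<Sum>j\<le>l. b j * (s\<^sup>2) ^ j)" using even by blast
    define r where "r \<tau> = (\<Sum>j\<le>l. b j * \<tau> ^ j)" for \<tau>
    have r0: "r 0 = w 0" using b[of 0] by (simp add: r_def)
    have r_eq: "r \<tau> = (w (?\<delta> 1 \<tau> x) + w (?\<delta> (- 1) \<tau> x)) / 2" if "\<tau> \<ge> 0" for \<tau>
    proof -
      have "sqrt \<tau> *\<^sub>R X + (sqrt \<tau>)\<^sup>2 *\<^sub>R Y = ?\<delta> 1 \<tau> x"
        "- sqrt \<tau> *\<^sub>R X + (sqrt \<tau>)\<^sup>2 *\<^sub>R Y = ?\<delta> (- 1) \<tau> x"
        using that by (simp_all add: X_def Y_def parabolic_dilation_def vec_eq_iff)
      then show ?thesis using b[of "sqrt \<tau>"] that by (simp add: r_def)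
    qed
    have "((\<lambda>\<tau>. (r \<tau>)\<^sup>2) has_integral integral {\<epsilon>..1} (\<lambda>\<tau>. (r \<tau>)\<^sup>2)) {\<epsilon>..1}"
      unfolding r_def by (intro integrable_integral integrable_continuous_real continuous_intros)
    then have int: "ennreal (integral {\<epsilon>..1} (\<lambda>\<tau>. (r \<tau>)\<^sup>2)) =
        (\<integral>\<^sup>+\<tau>. ennreal ((r \<tau>)\<^sup>2) * indicator {\<epsilon>..1} \<tau> \<partial>lborel)"
      by (intro nn_integral_has_integral_lebesgue'[symmetric]) auto
    have "(w 0)\<^sup>2 \<le> 16 * N\<^sup>2 * integral {\<epsilon>..1} (\<lambda>\<tau>. (r \<tau>)\<^sup>2)"
      using polynomial_endpoint_square_le_integral[of b l] r0
      unfolding r_def[symmetric] \<epsilon>_def N_def by simp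
    then have "?g 0 \<le> ennreal (16 * N\<^sup>2 * integral {\<epsilon>..1} (\<lambda>\<tau>. (r \<tau>)\<^sup>2))"
      by (rule ennreal_leI)
    also have "\<dots> = ennreal (16 * N\<^sup>2) * (\<integral>\<^sup>+\<tau>. ennreal ((r \<tau>)\<^sup>2) * indicator {\<epsilon>..1} \<tau> \<partial>lborel)"
      by (subst ennreal_mult') (simp_all add: int)
    also have "\<dots> \<le> ennreal (16 * N\<^sup>2) * (\<integral>\<^sup>+\<tau>. ennreal (1 / 2) * (?g (?\<delta> 1 \<tau> x) * indicator {\<epsilon>..1} \<tau>
        + ?g (?\<delta> (- 1) \<tau> x) * indicator {\<epsilon>..1} \<tau>) \<partial>lborel)"
    proof (intro mult_left_mono nn_integral_mono)
      fix \<tau> :: real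
      show "ennreal ((r \<tau>)\<^sup>2) * indicator {\<epsilon>..1} \<tau> \<le> ennreal (1 / 2) * (?g (?\<delta> 1 \<tau> x) * indicator {\<epsilon>..1} \<tau>
        + ?g (?\<delta> (- 1) \<tau> x) * indicator {\<epsilon>..1} \<tau>)"
      proof (cases "\<tau> \<in> {\<epsilon>..1}")
        case True
        define p q where "p = w (?\<delta> 1 \<tau> x)" and "q = w (?\<delta> (- 1) \<tau> x)"
        have "((p + q) / 2)\<^sup>2 \<le> 1 / 2 * (p\<^sup>2 + q\<^sup>2)"
          using zero_le_power2[of "p - q"] by (simp add: power2_eq_square field_simps)
        then have "(r \<tau>)\<^sup>2 \<le> 1 / 2 * (p\<^sup>2 + q\<^sup>2)"
          using True \<epsilon> by (subst r_eq) (auto simp: p_def q_def)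
        then have "ennreal ((r \<tau>)\<^sup>2) \<le> ennreal (1 / 2 * (p\<^sup>2 + q\<^sup>2))" by (rule ennreal_leI)
        also have "\<dots> = ennreal (1 / 2) * (ennreal (p\<^sup>2) + ennreal (q\<^sup>2))"
          by (subst ennreal_mult) auto
        finally show ?thesis using True by (simp add: p_def q_def)
      qed simp
    qed simp
    also have "\<dots> = ennreal (16 * N\<^sup>2) * (ennreal (1 / 2) * ((\<integral>\<^sup>+\<tau>. ?g (?\<delta> 1 \<tau> x) * indicator {\<epsilon>..1} \<tau> \<partial>lborel)
       + (\<integral>\<^sup>+\<tau>. ?g (?\<delta> (- 1) \<tau> x) * indicator {\<epsilon>..1} \<tau> \<partial>lborel)))"
      by (subst nn_integral_cmult, measurable) (subst nn_integral_add, measurable)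
    also have "ennreal (16 * N\<^sup>2) * (ennreal (1 / 2) * u) = ennreal (8 * N\<^sup>2) * u" for u
      unfolding mult.assoc[symmetric] by (subst ennreal_mult[symmetric]) simp_all
    finally show ?thesis .
  qed
  define M where "M = (\<integral>\<^sup>+x. ?g x * indicator (reference_domain z \<alpha>) x \<partial>lborel)"
  define K where "K = (\<Prod>i\<in>- {z}. (128 * N\<^sup>2) powr (1 / \<alpha> i))"
  have K: "K = 1 / (\<Prod>i\<in>- {z}. h i * sqrt \<epsilon>)"
  proof -
    have "(128 * N\<^sup>2) powr (1 / \<alpha> i) = 1 / (h i * sqrt \<epsilon>)" for i
    proof -
      have "\<epsilon> / 2 = 1 / (128 * N\<^sup>2)" by (simp add: \<epsilon>_def)
      then show ?thesis unfolding h_sqrt using N by (simp add: powr_divide)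
    qed
    then show ?thesis by (simp add: K_def prod_dividef)
  qed
  have K0: "K \<ge> 0" unfolding K_def by (intro prod_nonneg) simp
  have average: "(\<integral>\<^sup>+x. (\<integral>\<^sup>+\<tau>. ?g (?\<delta> \<sigma> \<tau> x) * indicator {\<epsilon>..1} \<tau> \<partial>lborel) * indicator B x \<partial>lborel)
      \<le> ennreal K * M" if "\<bar>\<sigma>\<bar> = 1" for \<sigma>
    unfolding K M_def B_def
    by (rule dilation_average_le) (use \<epsilon> h that sub B_def in auto)
  have "?g 0 * ennreal (1 / 2) = (\<integral>\<^sup>+x. ?g 0 * indicator B x \<partial>lborel)"
    by (subst nn_integral_cmult_indicator) (simp, simp only: B_def emeasure_dilation_box)
  also have "\<dots> \<le> (\<integral>\<^sup>+x. ennreal (8 * N\<^sup>2) *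
      ((\<integral>\<^sup>+\<tau>. ?g (?\<delta> 1 \<tau> x) * indicator {\<epsilon>..1} \<tau> \<partial>lborel) * indicator B x
       + (\<integral>\<^sup>+\<tau>. ?g (?\<delta> (- 1) \<tau> x) * indicator {\<epsilon>..1} \<tau> \<partial>lborel) * indicator B x) \<partial>lborel)"
    using pointwise by (intro nn_integral_mono) (auto simp: indicator_def)
  also have "\<dots> = ennreal (8 * N\<^sup>2) *
      ((\<integral>\<^sup>+x. (\<integral>\<^sup>+\<tau>. ?g (?\<delta> 1 \<tau> x) * indicator {\<epsilon>..1} \<tau> \<partial>lborel) * indicator B x \<partial>lborel)
       + (\<integral>\<^sup>+x. (\<integral>\<^sup>+\<tau>. ?g (?\<delta> (- 1) \<tau> x) * indicator {\<epsilon>..1} \<tau> \<partial>lborel) * indicator B x \<partial>lborel))"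
    by (subst nn_integral_cmult, measurable) (subst nn_integral_add, measurable)
  also have "\<dots> \<le> ennreal (8 * N\<^sup>2) * (ennreal K * M + ennreal K * M)"
    by (intro mult_left_mono add_mono average) auto
  finally have half: "?g 0 * ennreal (1 / 2) \<le> ennreal (8 * N\<^sup>2) * (ennreal K * M + ennreal K * M)" .
  have "ennreal 2 * ennreal (1 / 2) = 1"
    by (subst ennreal_mult[symmetric]) simp_all
  then have "?g 0 = ?g 0 * (ennreal 2 * ennreal (1 / 2))" by (simp only: mult_1_right)
  also have "\<dots> = ennreal 2 * (?g 0 * ennreal (1 / 2))" by (rule mult.left_commute)
  also have "\<dots> \<le> ennreal 2 * (ennreal (8 * N\<^sup>2) * (ennreal K * M + ennreal K * M))"
    by (intro mult_left_mono half) simp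
  also have "\<dots> = ennreal 2 * (ennreal (8 * N\<^sup>2) * (ennreal 2 * (ennreal K * M)))"
    by (simp add: mult_2)
  also have "\<dots> = ennreal (2 * (8 * N\<^sup>2) * 2 * K) * M"
  proof -
    have "ennreal (2 * a * 2 * K) = ennreal 2 * ennreal a * ennreal 2 * ennreal K" if "0 \<le> a" for a
      using that K0 by (simp only: ennreal_mult mult_nonneg_nonneg zero_le_numeral)
    from this[of "8 * N\<^sup>2"] have "ennreal (2 * (8 * N\<^sup>2) * 2 * K) = ennreal 2 * ennreal (8 * N\<^sup>2) * ennreal 2 * ennreal K"
      by simp
    then show ?thesis by (simp only: mult.assoc)
  qed
  also have "2 * (8 * N\<^sup>2) * 2 * K = 32 * N\<^sup>2 * K" by simp
  finally show ?thesis by (simp add: M_def K_def N_def)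
qed

section \<open>The bound for general domains\<close>

lemma continuous_on_affine_map:
  fixes A :: "'a::euclidean_space \<Rightarrow> 'b::real_normed_vector"
  assumes "affine_map A"
  shows "continuous_on S A"
proof -
  obtain L a where "linear L" and "A = (\<lambda>x. L x + a)"
    using assms by (auto simp: affine_map_def)
  then show ?thesis
    by (simp add: continuous_on_add linear_continuous_on linear_conv_bounded_linear)
qed

lemma integrable_on_compact_continuous:
  fixes f :: "'a::euclidean_space \<Rightarrow> real"
  assumes "compact S" "continuous_on S f"
  shows "f integrable_on S"
  using borel_integrable_compact[OF assms]
  by (intro set_borel_integral_eq_integral(1)) (simp add: set_integrable_def)

text \<open>
  The estimate at the cusp applies to \<open>v \<circ> A\<close>. The integral of its square over the reference domain \<open>R\<close> is to
  the integral of \<open>v\<^sup>2\<close> over the image as the volume of \<open>R\<close>, at most \<open>2 ^ CARD('d)\<close>, is to the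
  volume of the image.
\<close>
lemma affine_reference_domain_square_le:
  fixes z :: "'d::finite" and A :: "real ^ 'd \<Rightarrow> real ^ 'd"
  assumes \<alpha>: "\<And>i. i \<noteq> z \<Longrightarrow> 0 < \<alpha> i \<and> \<alpha> i \<le> 2"
    and A: "affine_map A" and v: "v \<in> poly_space l"
    and pos: "0 < measure lebesgue (A ` reference_domain z \<alpha>)"
  shows "(v (A 0))\<^sup>2 * measure lebesgue (A ` reference_domain z \<alpha>) \<le>
     2 ^ CARD('d) * (32 * (real l + 1)\<^sup>2 * (\<Prod>i\<in>- {z}. (128 * (real l + 1)\<^sup>2) powr (1 / \<alpha> i))) *
     integral (A ` reference_domain z \<alpha>) (\<lambda>y. (v y)\<^sup>2)"
proof -
  define R where "R = reference_domain z \<alpha>"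
  define M where "M = 32 * (real l + 1)\<^sup>2 * (\<Prod>i\<in>- {z}. (128 * (real l + 1)\<^sup>2) powr (1 / \<alpha> i))"
  obtain L a where L: "linear L" and A_eq: "A = (\<lambda>x. L x + a)"
    using A by (auto simp: affine_map_def)
  have compact_R: "compact R" unfolding R_def by (rule compact_reference_domain) (use \<alpha> in auto)
  have v_cont: "continuous_on S v" for S by (rule continuous_on_poly_space[OF v])
  have A_cont: "continuous_on S A" for S by (rule continuous_on_affine_map[OF A])
  have compact_AR: "compact (A ` R)"
    by (intro compact_continuous_image A_cont compact_R)
  have R_borel [measurable]: "R \<in> sets borel" "A ` R \<in> sets borel"
    using compact_R compact_AR by (auto intro: borel_compact)
  have v_borel [measurable]: "v \<in> borel_measurable borel"
    using v_cont by (rule borel_measurable_continuous_onI)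
  have inj: "inj L"
  proof (rule ccontr)
    assume "\<not> inj L"
    then have "negligible (L ` R)" by (rule negligible_linear_singular_image[OF L])
    then have "negligible ((+) a ` L ` R)" by (rule negligible_translation)
    moreover have "(+) a ` L ` R = A ` R" by (auto simp: A_eq image_iff add.commute)
    ultimately have "measure lebesgue (A ` R) = 0"
      by (simp add: negligible_iff_null_sets measure_eq_0_null_sets)
    then show False using pos by (simp add: R_def)
  qed
  have A_mem: "A w \<in> A ` R \<longleftrightarrow> w \<in> R" for w
    by (auto simp: A_eq dest: injD[OF inj])
  define I where "I = (\<integral>\<^sup>+y. ennreal ((v y)\<^sup>2) * indicator (A ` R) y \<partial>lborel)"
  define \<mu> where "\<mu> = emeasure lborel (A ` R)"
  have \<mu>: "\<mu> = (\<integral>\<^sup>+x. indicator (A ` R) x \<partial>lborel)" by (simp add: \<mu>_def)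
  have change: "(\<integral>\<^sup>+w. ennreal ((v (A w))\<^sup>2) * indicator R w \<partial>lborel) * \<mu> = I * emeasure lborel R"
  proof -
    \<comment> \<open>Proportionality for the linear part of \<open>A\<close>, with both functions shifted by its constant part.\<close>
    define f g :: "real ^ 'd \<Rightarrow> ennreal"
      where "f x = indicator (A ` R) (x + a)" and "g x = ennreal ((v (x + a))\<^sup>2) * indicator (A ` R) (x + a)" for x
    have [measurable]: "f \<in> borel_measurable borel" "g \<in> borel_measurable borel"
      unfolding f_def g_def by measurable
    have "(\<integral>\<^sup>+w. g (L w) \<partial>lborel) * (\<integral>\<^sup>+x. f x \<partial>lborel)
        = (\<integral>\<^sup>+x. g x \<partial>lborel) * (\<integral>\<^sup>+w. f (L w) \<partial>lborel)"
      by (rule nn_integral_linear_proportional[OF L inj]) measurable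
    moreover have "(\<integral>\<^sup>+x. f x \<partial>lborel) = \<mu>"
      unfolding \<mu> f_def using nn_integral_lborel_translate[of "indicator (A ` R)" "- a"] by simp
    moreover have "(\<integral>\<^sup>+x. g x \<partial>lborel) = I"
      unfolding I_def g_def
      using nn_integral_lborel_translate[of "\<lambda>y. ennreal ((v y)\<^sup>2) * indicator (A ` R) y" "- a"] by simp
    moreover have "g (L w) = ennreal ((v (A w))\<^sup>2) * indicator R w" for w
      using A_mem[of w] by (simp add: g_def A_eq indicator_def)
    moreover have "f (L w) = indicator R w" for w
      using A_mem[of w] by (simp add: f_def A_eq indicator_def)
    ultimately show ?thesis by simp
  qed
  have bound: "ennreal ((v (A 0))\<^sup>2) \<le> ennreal M * (\<integral>\<^sup>+w. ennreal ((v (A w))\<^sup>2) * indicator R w \<partial>lborel)"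
    unfolding M_def R_def
  proof (rule reference_domain_square_le_nn_integral)
    show "continuous_on UNIV (\<lambda>w. v (A w))"
      by (rule continuous_on_compose2[OF v_cont[of UNIV] A_cont]) simp
  qed (use \<alpha> poly_space_even_along_parabola[OF v A] in auto)
  have "ennreal ((v (A 0))\<^sup>2) * \<mu> \<le> ennreal M * (I * emeasure lborel R)"
    using mult_right_mono[OF bound, of \<mu>] by (simp add: mult.assoc change)
  also have "emeasure lborel R \<le> ennreal (2 ^ CARD('d))"
  proof -
    have "emeasure lborel R \<le> emeasure lborel (cbox (- 1) (1 :: real ^ 'd))"
      unfolding R_def by (intro emeasure_mono reference_domain_subset_cbox) simp
    also have "\<dots> = ennreal (measure lborel (cbox (- 1) (1 :: real ^ 'd)))"
      using emeasure_lborel_cbox_finite[of "- 1" "1 :: real ^ 'd"]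
      by (intro emeasure_eq_ennreal_measure) auto
    also have "measure lborel (cbox (- 1) (1 :: real ^ 'd)) = 2 ^ CARD('d)"
      by (subst content_cbox_cart) (auto simp: interval_ne_empty_cart)
    finally show ?thesis .
  qed
  finally have le: "ennreal ((v (A 0))\<^sup>2) * \<mu> \<le> ennreal M * (I * ennreal (2 ^ CARD('d)))"
    by (simp add: mult_left_mono)
  have \<mu>_eq: "\<mu> = ennreal (measure lebesgue (A ` R))"
  proof -
    have "\<mu> = emeasure lebesgue (A ` R)" using R_borel(2) by (simp add: \<mu>_def)
    also have "\<dots> = ennreal (measure lebesgue (A ` R))"
      by (intro emeasure_eq_measure2 lmeasurable_compact compact_AR)
    finally show ?thesis .
  qed
  have int: "(\<lambda>y. (v y)\<^sup>2) integrable_on (A ` R)"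
    by (intro integrable_on_compact_continuous compact_AR continuous_intros v_cont)
  have I_eq: "I = ennreal (integral (A ` R) (\<lambda>y. (v y)\<^sup>2))"
    unfolding I_def by (rule nn_integral_has_integral_lebesgue') (use int in auto)
  have J: "0 \<le> integral (A ` R) (\<lambda>y. (v y)\<^sup>2)" by (rule integral_nonneg[OF int]) simp
  have M: "0 \<le> M" unfolding M_def by (intro mult_nonneg_nonneg prod_nonneg) auto
  from le have "ennreal ((v (A 0))\<^sup>2 * measure lebesgue (A ` R))
      \<le> ennreal (M * (integral (A ` R) (\<lambda>y. (v y)\<^sup>2) * 2 ^ CARD('d)))"
    unfolding \<mu>_eq I_eq using J M by (simp add: ennreal_mult)
  then have "(v (A 0))\<^sup>2 * measure lebesgue (A ` R) \<le> M * (integral (A ` R) (\<lambda>y. (v y)\<^sup>2) * 2 ^ CARD('d))"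
    using J M by (subst (asm) ennreal_le_iff) auto
  then show ?thesis unfolding R_def[symmetric] M_def[symmetric] by (simp only: mult_ac)
qed

lemma L2_norm_on_square:
  fixes D :: "(real ^ 'd::finite) set"
  assumes "open D" "bounded D" and v: "continuous_on UNIV v"
  shows "(L2_norm_on D v)\<^sup>2 = integral D (\<lambda>x. (v x)\<^sup>2) / measure lebesgue D"
    and "(\<lambda>x. (v x)\<^sup>2) integrable_on D"
proof -
  have "set_integrable lborel (closure D) (\<lambda>x. (v x)\<^sup>2)"
    unfolding set_integrable_def using assms
    by (intro borel_integrable_compact continuous_intros) (auto intro: continuous_on_subset)
  then have "set_integrable lborel D (\<lambda>x. (v x)\<^sup>2)"
    by (rule set_integrable_subset) (use assms closure_subset in auto)
  then show int: "(\<lambda>x. (v x)\<^sup>2) integrable_on D"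
    by (rule set_borel_integral_eq_integral)
  have D_leb [measurable]: "D \<in> sets lebesgue" using assms by (simp add: borel_open)
  have [measurable]: "v \<in> borel_measurable lebesgue"
    using borel_measurable_continuous_onI[OF v] by (simp add: measurable_completion)
  have fin: "emeasure lebesgue D = ennreal (measure lebesgue D)"
    using assms by (intro emeasure_eq_measure2 lmeasurable_open)
  have nonneg: "0 \<le> integral D (\<lambda>x. (v x)\<^sup>2)" by (rule integral_nonneg[OF int]) simp
  have "(\<integral>\<^sup>+x. ennreal ((v x)\<^sup>2) \<partial>uniform_measure lebesgue D)
      = (\<integral>\<^sup>+x. ennreal ((v x)\<^sup>2) * indicator D x \<partial>lebesgue) / emeasure lebesgue D"
    by (rule nn_integral_uniform_measure) measurable
  also have "(\<integral>\<^sup>+x. ennreal ((v x)\<^sup>2) * indicator D x \<partial>lebesgue) = ennreal (integral D (\<lambda>x. (v x)\<^sup>2))"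
    unfolding nn_integral_completion by (rule nn_integral_has_integral_lebesgue') (use int in auto)
  finally have nn: "(\<integral>\<^sup>+x. ennreal ((v x)\<^sup>2) \<partial>uniform_measure lebesgue D)
      = ennreal (integral D (\<lambda>x. (v x)\<^sup>2)) / ennreal (measure lebesgue D)" by (simp add: fin)
  have "(\<integral>x. \<bar>v x\<bar>\<^sup>2 \<partial>uniform_measure lebesgue D)
      = enn2real (\<integral>\<^sup>+x. ennreal ((v x)\<^sup>2) \<partial>uniform_measure lebesgue D)"
    by (subst integral_eq_nn_integral) (simp_all add: uniform_measure_def)
  also have "\<dots> = integral D (\<lambda>x. (v x)\<^sup>2) / measure lebesgue D"
  proof (cases "measure lebesgue D = 0")
    case True
    then have "integral D (\<lambda>x. (v x)\<^sup>2) = 0"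
      using D_leb assms fin
      by (intro integral_unique has_integral_negligible[of D]) (auto simp: negligible_iff_null_sets null_sets_def)
    then show ?thesis using True by (simp add: nn)
  next
    case False
    then have "0 < measure lebesgue D" by (simp add: zero_less_measure_iff)
    then show ?thesis using nonneg by (simp add: nn divide_ennreal)
  qed
  finally show "(L2_norm_on D v)\<^sup>2 = integral D (\<lambda>x. (v x)\<^sup>2) / measure lebesgue D"
    using nonneg by (simp add: L2_norm_on_def)
qed

text \<open>
  This converts the powers of the degree into powers of the dimension \<open>n\<close> of the polynomial space.
\<close>
lemma degree_le_dimension_power:
  fixes d l :: nat
  assumes "0 < d"
  shows "real l + 1 \<le> real d * real ((d + l) choose d) powr (1 / real d)"
proof -
  have "(real l + 1) / real d \<le> real (d + l) / real d"
    using assms by (intro divide_right_mono) auto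
  also have "\<dots> = ((real (d + l) / real d) ^ d) powr (1 / real d)"
    using assms by (simp add: powr_realpow[symmetric] powr_powr)
  also have "\<dots> \<le> real ((d + l) choose d) powr (1 / real d)"
    using binomial_ge_n_over_k_pow_k[of d "d + l", where 'a = real] by (intro powr_mono2) auto
  finally show ?thesis using assms by (simp add: field_simps)
qed

theorem theorem5p9:
  fixes D :: "(real ^ 'd::finite) set" and z :: 'd and \<alpha> :: "'d \<Rightarrow> real" and \<beta> :: real
  assumes "open D" and "bounded D"
    and "negligible (frontier D)"
    and "\<And>i. i \<noteq> z \<Longrightarrow> 0 < \<alpha> i \<and> \<alpha> i \<le> 2"
    and "0 < \<beta>"
    and "\<And>x. x \<in> D \<Longrightarrow>
           \<exists>A :: real ^ 'd \<Rightarrow> real ^ 'd. affine_map A \<and> A 0 = x \<and>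
             A ` reference_domain z \<alpha> \<subseteq> closure D \<and>
             measure lebesgue (A ` reference_domain z \<alpha>) \<ge> \<beta> * measure lebesgue D"
  shows "\<exists>C>0. \<forall>l n. n = (CARD('d) + l) choose CARD('d) \<longrightarrow>
           K_sup (poly_space l) D
             \<le> ennreal (C * real n powr (1 / real CARD('d) * (2 + (\<Sum>i\<in>- {z}. 2 / \<alpha> i))))"
proof -
  define d where "d = CARD('d)"
  define s where "s = 2 + (\<Sum>i\<in>- {z}. 2 / \<alpha> i)"
  define K where "K = 2 ^ d * 32 * (\<Prod>i\<in>- {z}. 128 powr (1 / \<alpha> i)) / \<beta>"
  define C where "C = K * real d powr s"
  have d: "0 < d" by (simp add: d_def)
  have s: "0 \<le> s" unfolding s_def using assms(4)
    by (intro add_nonneg_nonneg sum_nonneg divide_nonneg_nonneg) (auto intro: less_imp_le)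
  have K: "0 < K" unfolding K_def using assms(5) by (intro divide_pos_pos mult_pos_pos prod_pos) auto
  have C: "0 < C" unfolding C_def using K d by simp
  \<comment> \<open>The case of a vanishing norm is covered, since then the quotient is \<open>0\<close>.\<close>
  have point: "\<bar>v x\<bar>\<^sup>2 / (L2_norm_on D v)\<^sup>2 \<le> K * (real l + 1) powr s"
    if x: "x \<in> D" and v: "v \<in> poly_space l" for x v l
  proof -
    obtain A where A: "affine_map A" "A 0 = x" "A ` reference_domain z \<alpha> \<subseteq> closure D"
      and vol: "\<beta> * measure lebesgue D \<le> measure lebesgue (A ` reference_domain z \<alpha>)"
      using assms(6)[OF x] by blast
    let ?R = "A ` reference_domain z \<alpha>"
    define N where "N = real l + 1"
    define M where "M = 2 ^ d * (32 * N\<^sup>2 * (\<Prod>i\<in>- {z}. (128 * N\<^sup>2) powr (1 / \<alpha> i)))"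
    define J where "J = integral D (\<lambda>y. (v y)\<^sup>2)"
    define m where "m = measure lebesgue D"
    have N: "0 < N" by (simp add: N_def)
    have "\<not> negligible D" using x assms(1) open_not_negligible by blast
    then have m: "0 < m"
      unfolding m_def using assms(1,2)
      by (simp add: lmeasurable_open negligible_iff_measure zero_less_measure_iff)
    then have \<beta>m: "0 < \<beta> * m" using assms(5) by simp
    have vol_pos: "0 < measure lebesgue ?R" using vol \<beta>m unfolding m_def by linarith
    have v_cont: "continuous_on S v" for S by (rule continuous_on_poly_space[OF v])
    have L2: "(L2_norm_on D v)\<^sup>2 = J / m"
      unfolding J_def m_def by (rule L2_norm_on_square(1)[OF assms(1,2) v_cont])
    have int_D: "(\<lambda>y. (v y)\<^sup>2) integrable_on D"
      by (rule L2_norm_on_square(2)[OF assms(1,2) v_cont])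
    have "compact (reference_domain z \<alpha>)"
      by (rule compact_reference_domain) (use assms(4) in auto)
    then have "compact ?R"
      by (intro compact_continuous_image continuous_on_affine_map A(1))
    then have int_R: "(\<lambda>y. (v y)\<^sup>2) integrable_on ?R"
      by (intro integrable_on_compact_continuous continuous_intros v_cont)
    have null: "negligible (closure D - D)"
      using assms(1,3) by (simp add: frontier_def interior_open)
    have M: "0 \<le> M" unfolding M_def by (intro mult_nonneg_nonneg prod_nonneg) auto
    have J: "0 \<le> J" unfolding J_def by (rule integral_nonneg[OF int_D]) simp
    have J_closure: "integral (closure D) (\<lambda>y. (v y)\<^sup>2) = J"
      and int_closure: "(\<lambda>y. (v y)\<^sup>2) integrable_on closure D"
    proof -
      have "D - closure D = {}" using closure_subset by auto
      then show "integral (closure D) (\<lambda>y. (v y)\<^sup>2) = J"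
        unfolding J_def by (intro integral_spike_set negligible_subset[OF null]) auto
      show "(\<lambda>y. (v y)\<^sup>2) integrable_on closure D"
        using int_D by (rule integrable_spike_set) (use \<open>D - closure D = {}\<close> in \<open>auto intro: negligible_subset[OF null]\<close>)
    qed
    have "(v x)\<^sup>2 * (\<beta> * m) \<le> (v (A 0))\<^sup>2 * measure lebesgue ?R"
      using vol A(2) by (auto simp: m_def intro: mult_left_mono)
    also have "\<dots> \<le> M * integral ?R (\<lambda>y. (v y)\<^sup>2)"
      unfolding M_def N_def d_def
      by (rule affine_reference_domain_square_le) (use assms(4) A(1) v vol_pos in auto)
    also have "\<dots> \<le> M * J"
      unfolding J_closure[symmetric]
      by (intro mult_left_mono integral_subset_le int_R int_closure A(3) M) auto
    finally have main: "(v x)\<^sup>2 * (\<beta> * m) \<le> M * J" .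
    have M_eq: "M / \<beta> = K * N powr s"
    proof -
      have "(128 * N\<^sup>2) powr (1 / \<alpha> i) = 128 powr (1 / \<alpha> i) * N powr (2 / \<alpha> i)" for i
        using N by (simp add: powr_mult powr_powr flip: powr_numeral)
      then have "(\<Prod>i\<in>- {z}. (128 * N\<^sup>2) powr (1 / \<alpha> i))
          = (\<Prod>i\<in>- {z}. 128 powr (1 / \<alpha> i)) * N powr (\<Sum>i\<in>- {z}. 2 / \<alpha> i)"
        using N by (simp add: prod.distrib powr_sum)
      moreover have "N powr s = N\<^sup>2 * N powr (\<Sum>i\<in>- {z}. 2 / \<alpha> i)"
        using N by (simp add: s_def powr_add)
      ultimately show ?thesis by (simp add: M_def K_def)
    qed
    show ?thesis
    proof (cases "J = 0")
      case True
      then show ?thesis using K by (simp add: L2)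
    next
      case False
      with J have "0 < J" by simp
      have "\<bar>v x\<bar>\<^sup>2 / (L2_norm_on D v)\<^sup>2 = (v x)\<^sup>2 * (\<beta> * m) / (\<beta> * J)"
        using assms(5) by (simp add: L2)
      also have "\<dots> \<le> M * J / (\<beta> * J)"
        using main \<open>0 < J\<close> assms(5) by (intro divide_right_mono) auto
      also have "\<dots> = K * N powr s" using \<open>0 < J\<close> by (simp flip: M_eq)
      finally show ?thesis by (simp add: N_def)
    qed
  qed
  have "K_sup (poly_space l) D \<le> ennreal (C * real ((d + l) choose d) powr (1 / real d * s))" for l
  proof -
    define n where "n = (d + l) choose d"
    have "(real l + 1) powr s \<le> (real d * real n powr (1 / real d)) powr s"
      unfolding n_def using s by (intro powr_mono2 degree_le_dimension_power d) auto
    also have "\<dots> = real d powr s * real n powr (1 / real d * s)"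
      by (simp add: powr_mult powr_powr)
    finally have "K * (real l + 1) powr s \<le> C * real n powr (1 / real d * s)"
      using K by (simp add: C_def mult.assoc)
    then show ?thesis
      unfolding K_sup_def k_fun_def n_def[symmetric]
      by (intro SUP_least ennreal_leI) (use point in \<open>force intro: order_trans\<close>)
  qed
  then show ?thesis
    using C unfolding s_def d_def by blast
qed

end
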